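(* Let $\alpha\in\mathbb R$, let $\kappa\in\mathbb N\cup\{+\infty\}$, and let $(s_j)_{j=0}^\kappa$ be a sequence of complex $q\times q$ matrices. Define $s_j^{(\alpha)}=-s_{j+1}^{\sharp,\alpha}$ for all integers $j$ with $0\le j\le\kappa-1$. Then: (a) If $(s_j)_{j=0}^\kappa\in\mathcal K^{\ge}_{q,\kappa,\alpha}$, then $(s_j^{(\alpha)})_{j=0}^{\kappa-1}\in\mathcal K^{\ge}_{q,\kappa-1,\alpha}$. (b) If $(s_j)_{j=0}^\kappa\in\mathcal K^{\ge,e}_{q,\kappa,\alpha}$, then $(s_j^{(\alpha)})_{j=0}^{\kappa-1}\in\mathcal K^{\ge,e}_{q,\kappa-1,\alpha}$. (c) If $(s_j)_{j=0}^\kappa\in\mathcal K^{>}_{q,\kappa,\alpha}$, then $(s_j^{(\alpha)})_{j=0}^{\kappa-1}\in\mathcal K^{>}_{q,\kappa-1,\alpha}$. (d) If $m$ is an integer with $0\le m\le\kappa$ and $(s_j)_{j=0}^\kappa\in\mathcal K^{\ge,cd,m}_{q,\kappa,\alpha}$, then $(s_j^{(\alpha)})_{j=0}^{\kappa-1}\in\mathcal K^{\ge,cd,\max\{0,m-1\}}_{q,\kappa-1,\alpha}$. (e) If $(s_j)_{j=0}^\kappa\in\mathcal K^{\ge,cd}_{q,\kappa,\alpha}$, then $(s_j^{(\alpha)})_{j=0}^{\kappa-1}\in\mathcal K^{\ge,cd}_{q,\kappa-1,\alpha}$.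
   Context: Let $q\in\mathbb N=\{1,2,\dots\}$; $\mathbb N_0=\{0,1,2,\dots\}$. All sequences consist of complex $q\times q$ matrices; $(s_j)_{j=0}^{\infty}$ is indexed by $\mathbb N_0$, and $\infty-1=\infty$. $A\ge0$ (resp. $A>0$) means that $A$ is nonnegative (resp. positive) Hermitian, i.e. Hermitian positive semidefinite (resp. definite), and $A^\dagger$ is the Moore–Penrose inverse of $A$. Reciprocal sequences. The $[+,\alpha]$-transform of $(s_j)$ is $(u_j)$ with $u_j=-\alpha s_{j-1}+s_j$, where $s_{-1}=0$. The reciprocal sequence of a sequence $(u_j)$ is given by $u_0^\sharp=u_0^\dagger$ and $u_j^\sharp=-u_0^\dagger\sum_{l=0}^{j-1}u_{j-l}u_l^\sharp$ for $j\ge1$. Put $s_j^{\sharp,\alpha}=u_j^\sharp$ where $(u_j)$ is the $[+,\alpha]$-transform of $(s_j)$. Block Hankel matrices. For a sequence $(s_j)$ put $H_n=[s_{j+k}]_{j,k=0}^n$, $s_{\alpha,j}=-\alpha s_j+s_{j+1}$, and $H_{\alpha,n}=[s_{\alpha,j+k}]_{j,k=0}^n$ (whenever the entries are available). Put $L_0=s_0$ and, for $n\ge1$, $L_n=s_{2n}-[s_n,\dots,s_{2n-1}]\,H_{n-1}^\dagger\,\begin{bmatrix}s_n\\ \vdots\\ s_{2n-1}\end{bmatrix}$; let $L_{\alpha,n}$ be the matrix built in the same way from $(s_{\alpha,j})$ in place of $(s_j)$ (so $L_{\alpha,0}=s_{\alpha,0}$). Classes. $\mathcal K^{\ge}_{q,0,\alpha}$: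 all $(s_j)_{j=0}^0$ with $s_0\ge0$. For $n\ge1$, $\mathcal K^{\ge}_{q,2n,\alpha}$: all $(s_j)_{j=0}^{2n}$ with $H_n\ge0$ and $H_{\alpha,n-1}\ge0$. For $n\ge0$, $\mathcal K^{\ge}_{q,2n+1,\alpha}$: all $(s_j)_{j=0}^{2n+1}$ with $H_n\ge0$ and $H_{\alpha,n}\ge0$. $\mathcal K^{>}_{q,m,\alpha}$ is defined in the same way with $>0$ in place of $\ge0$ everywhere. $\mathcal K^{\ge}_{q,\infty,\alpha}$ (resp. $\mathcal K^{>}_{q,\infty,\alpha}$): all $(s_j)_{j=0}^\infty$ with $(s_j)_{j=0}^m\in\mathcal K^{\ge}_{q,m,\alpha}$ (resp. $\mathcal K^{>}_{q,m,\alpha}$) for all $m\in\mathbb N_0$. For $m\in\mathbb N_0$, $\mathcal K^{\ge,e}_{q,m,\alpha}$: all $(s_j)_{j=0}^m$ for which there is a complex $q\times q$ matrix $s_{m+1}$ with $(s_j)_{j=0}^{m+1}\in\mathcal K^{\ge}_{q,m+1,\alpha}$; $\mathcal K^{\ge,e}_{q,\infty,\alpha}=\mathcal K^{\ge}_{q,\infty,\alpha}$. For $n\ge0$, $\mathcal K^{\ge,cd}_{q,2n,\alpha}$: all $(s_j)_{j=0}^{2n}\in\mathcal K^{\ge}_{q,2n,\alpha}$ with $L_n=0$; $\mathcal K^{\ge,cd}_{q,2n+1,\alpha}$: all $(s_j)_{j=0}^{2n+1}\in\mathcal K^{\ge}_{q,2n+1,\alpha}$ with $L_{\alpha,n}=0$;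 $\mathcal K^{\ge,cd}_{q,\infty,\alpha}$: all $(s_j)_{j=0}^\infty\in\mathcal K^{\ge}_{q,\infty,\alpha}$ for which there is $m\in\mathbb N_0$ with $(s_j)_{j=0}^m\in\mathcal K^{\ge,cd}_{q,m,\alpha}$. For an integer $0\le m\le\kappa$, $\mathcal K^{\ge,cd,m}_{q,\kappa,\alpha}$: all $(s_j)_{j=0}^\kappa\in\mathcal K^{\ge}_{q,\kappa,\alpha}$ with $(s_j)_{j=0}^m\in\mathcal K^{\ge,cd}_{q,m,\alpha}$. *)

theory Defs
  imports "Jordan_Normal_Form.Schur_Decomposition" "HOL-Library.Extended_Nat"
begin

text \<open>
  A sequence $(s_j)_{j=0}^\kappa$ of complex $q \times q$ matrices is a function
  \<open>s :: nat \<Rightarrow> complex mat\<close> of which only the values \<open>s j\<close> with \<open>enat j \<le> \<kappa>\<close> matter: the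
  length \<open>\<kappa> :: enat\<close> is a parameter of every class of sequences below, and membership does
  not depend on the values beyond \<open>\<kappa>\<close>.
\<close>

subsection \<open>Matrices\<close>

definition nonneg_hermitian :: "complex mat \<Rightarrow> bool" where
  "nonneg_hermitian A \<longleftrightarrow> mat_adjoint A = A \<and>
     (\<forall>x \<in> carrier_vec (dim_row A). 0 \<le> (A *\<^sub>v x) \<bullet>c x)"

definition pos_hermitian :: "complex mat \<Rightarrow> bool" where
  "pos_hermitian A \<longleftrightarrow> mat_adjoint A = A \<and>
     (\<forall>x \<in> carrier_vec (dim_row A). x \<noteq> 0\<^sub>v (dim_row A) \<longrightarrow> 0 < (A *\<^sub>v x) \<bullet>c x)"

definition moore_penrose :: "complex mat \<Rightarrow> complex mat \<Rightarrow> bool" where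
  "moore_penrose A X \<longleftrightarrow> X \<in> carrier_mat (dim_col A) (dim_row A) \<and>
     A * X * A = A \<and> X * A * X = X \<and>
     mat_adjoint (A * X) = A * X \<and> mat_adjoint (X * A) = X * A"

definition pinv :: "complex mat \<Rightarrow> complex mat" where
  "pinv A = (THE X. moore_penrose A X)"

definition mat_sum :: "nat \<Rightarrow> nat \<Rightarrow> ('i \<Rightarrow> complex mat) \<Rightarrow> 'i set \<Rightarrow> complex mat" where
  "mat_sum nr nc f I = mat nr nc (\<lambda>ij. \<Sum>l\<in>I. f l $$ ij)"

lemma mat_sum_cong [fundef_cong]:
  assumes "I = J" "\<And>l. l \<in> J \<Longrightarrow> f l = g l"
  shows "mat_sum nr nc f I = mat_sum nr nc g J"
  unfolding mat_sum_def using assms by (simp cong: sum.cong)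

text \<open>The matrix of \<open>m \<times> n\<close> blocks of size \<open>q \<times> q\<close>, the block at position \<open>(j, k)\<close> being \<open>B j k\<close>.\<close>

definition block_matrix :: "nat \<Rightarrow> nat \<Rightarrow> nat \<Rightarrow> (nat \<Rightarrow> nat \<Rightarrow> complex mat) \<Rightarrow> complex mat" where
  "block_matrix q m n B =
     mat (m * q) (n * q) (\<lambda>(a, b). B (a div q) (b div q) $$ (a mod q, b mod q))"

subsection \<open>Reciprocal sequences\<close>

definition plus_transform :: "nat \<Rightarrow> real \<Rightarrow> (nat \<Rightarrow> complex mat) \<Rightarrow> nat \<Rightarrow> complex mat" where
  "plus_transform q \<alpha> s j =
     complex_of_real (- \<alpha>) \<cdot>\<^sub>m (case j of 0 \<Rightarrow> 0\<^sub>m q q | Suc i \<Rightarrow> s i) + s j"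

fun reciprocal :: "nat \<Rightarrow> (nat \<Rightarrow> complex mat) \<Rightarrow> nat \<Rightarrow> complex mat" where
  "reciprocal q u 0 = pinv (u 0)"
| "reciprocal q u (Suc j) =
     - pinv (u 0) * mat_sum q q (\<lambda>l. u (Suc j - l) * reciprocal q u l) {..<Suc j}"

definition alpha_reciprocal :: "nat \<Rightarrow> real \<Rightarrow> (nat \<Rightarrow> complex mat) \<Rightarrow> nat \<Rightarrow> complex mat" where
  "alpha_reciprocal q \<alpha> s = reciprocal q (plus_transform q \<alpha> s)"

text \<open>The sequence written $s^{(\alpha)}$. Its entry at \<open>j\<close> depends only on \<open>s 0, \<dots>, s (j + 1)\<close>.\<close>

definition alpha_step :: "nat \<Rightarrow> real \<Rightarrow> (nat \<Rightarrow> complex mat) \<Rightarrow> nat \<Rightarrow> complex mat" where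
  "alpha_step q \<alpha> s j = - alpha_reciprocal q \<alpha> s (j + 1)"

subsection \<open>Block Hankel matrices\<close>

definition block_hankel :: "nat \<Rightarrow> (nat \<Rightarrow> complex mat) \<Rightarrow> nat \<Rightarrow> complex mat" where
  "block_hankel q s n = block_matrix q (n + 1) (n + 1) (\<lambda>j k. s (j + k))"

definition alpha_shift :: "real \<Rightarrow> (nat \<Rightarrow> complex mat) \<Rightarrow> nat \<Rightarrow> complex mat" where
  "alpha_shift \<alpha> s j = complex_of_real (- \<alpha>) \<cdot>\<^sub>m s j + s (j + 1)"

definition hankel_schur :: "nat \<Rightarrow> (nat \<Rightarrow> complex mat) \<Rightarrow> nat \<Rightarrow> complex mat" where
  "hankel_schur q s n = (if n = 0 then s 0 else
     s (2 * n) - block_matrix q 1 n (\<lambda>_ k. s (n + k)) * pinv (block_hankel q s (n - 1))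
       * block_matrix q n 1 (\<lambda>j _. s (n + j)))"

subsection \<open>Classes of sequences\<close>

text \<open>
  The classes for \<open>\<ge>\<close> and for \<open>>\<close> differ only in the predicate \<open>P\<close> imposed on the block Hankel
  matrices.
\<close>

definition K_finite :: "(complex mat \<Rightarrow> bool) \<Rightarrow> nat \<Rightarrow> real \<Rightarrow> nat \<Rightarrow> (nat \<Rightarrow> complex mat) set" where
  "K_finite P q \<alpha> m = {s. (\<forall>j\<le>m. s j \<in> carrier_mat q q) \<and>
     (if m = 0 then P (s 0)
      else if even m then
        P (block_hankel q s (m div 2)) \<and> P (block_hankel q (alpha_shift \<alpha> s) (m div 2 - 1))
      else
        P (block_hankel q s (m div 2)) \<and> P (block_hankel q (alpha_shift \<alpha> s) (m div 2)))}"

definition K_class :: "(complex mat \<Rightarrow> bool) \<Rightarrow> nat \<Rightarrow> real \<Rightarrow> enat \<Rightarrow> (nat \<Rightarrow> complex mat) set" where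
  "K_class P q \<alpha> \<kappa> =
     (case \<kappa> of enat m \<Rightarrow> K_finite P q \<alpha> m | \<infinity> \<Rightarrow> {s. \<forall>m. s \<in> K_finite P q \<alpha> m})"

definition K_nonneg :: "nat \<Rightarrow> real \<Rightarrow> enat \<Rightarrow> (nat \<Rightarrow> complex mat) set" where
  "K_nonneg = K_class nonneg_hermitian"

definition K_pos :: "nat \<Rightarrow> real \<Rightarrow> enat \<Rightarrow> (nat \<Rightarrow> complex mat) set" where
  "K_pos = K_class pos_hermitian"

definition K_nonneg_ext :: "nat \<Rightarrow> real \<Rightarrow> enat \<Rightarrow> (nat \<Rightarrow> complex mat) set" where
  "K_nonneg_ext q \<alpha> \<kappa> =
     (case \<kappa> of
        enat m \<Rightarrow> {s. \<exists>S \<in> carrier_mat q q. s(m + 1 := S) \<in> K_nonneg q \<alpha> (enat (m + 1))}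
      | \<infinity> \<Rightarrow> K_nonneg q \<alpha> \<infinity>)"

definition K_cd_finite :: "nat \<Rightarrow> real \<Rightarrow> nat \<Rightarrow> (nat \<Rightarrow> complex mat) set" where
  "K_cd_finite q \<alpha> m = {s \<in> K_nonneg q \<alpha> (enat m).
     (if even m then hankel_schur q s (m div 2) = 0\<^sub>m q q
      else hankel_schur q (alpha_shift \<alpha> s) (m div 2) = 0\<^sub>m q q)}"

definition K_cd :: "nat \<Rightarrow> real \<Rightarrow> enat \<Rightarrow> (nat \<Rightarrow> complex mat) set" where
  "K_cd q \<alpha> \<kappa> =
     (case \<kappa> of
        enat m \<Rightarrow> K_cd_finite q \<alpha> m
      | \<infinity> \<Rightarrow> {s \<in> K_nonneg q \<alpha> \<infinity>. \<exists>m. s \<in> K_cd_finite q \<alpha> m})"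

definition K_cd_order :: "nat \<Rightarrow> real \<Rightarrow> enat \<Rightarrow> nat \<Rightarrow> (nat \<Rightarrow> complex mat) set" where
  "K_cd_order q \<alpha> \<kappa> m = {s \<in> K_nonneg q \<alpha> \<kappa>. s \<in> K_cd_finite q \<alpha> m}"

end

theory Submission
  imports Defs "HOL-Library.Function_Algebras"
begin

text \<open>
  Let $(u_j)$ be the $[+,\alpha]$-transform of $(s_j)$, $(v_j)$ its reciprocal sequence and
  $t_j = -v_{j+1}$ the sequence $s^{(\alpha)}$. Both Hankel conditions on $(t_j)$ follow from
  congruences with Hankel matrices of $(s_j)$. Suppose first that $s_0$ is invertible and work
  with the formal power series $s$, $u = (1 - \alpha z) s$, $v = u^{-1}$ and $w = s^{-1} = (1 - \alpha z) v$.
  The block Hankel matrix of a sequence $h$ has the two-variable generating function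
  $(x h(x) - y h(y)) / (x - y)$. As $z\, t = v_0 - v$ and $u = u_0 + z\, s_\alpha$ with $s_{\alpha,j} = u_{j+1}$,

    \<^item> $x t(x) - y t(y) = v(y) - v(x) = v(x) (u(x) - u(y)) v(y) = v(x) (x s_\alpha(x) - y s_\alpha(y)) v(y)$,
      so the Hankel matrix of $t$ is that of $s_\alpha$, multiplied by a lower triangular block
      Toeplitz matrix of $v$ on the left and by its adjoint on the right;
    \<^item> $t_{\alpha,j} = -w_{j+2}$, and the same computation with $s$, $w$ shows that the congruence by
      the block Toeplitz matrix of $w$ turns the Hankel matrix $H_{n+1}$ of $s$ into the block
      diagonal matrix with the blocks $w_0$ and the Hankel matrix $H_n$ of $t_\alpha$.

  For singular $s_0$ the orthogonal projection $E = s_0 s_0^\dagger$ takes the role of the unit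
  matrix. Since $v_j = E v_j E$, the sequence $v$ is the inverse of the compressed sequence
  $E u_j E$ relative to $E$, whatever the $u_j$ are, and the Hankel matrix of the compressed sequence
  inherits nonnegativity. This gives (a). Under the hypothesis of (c) $E$ is the unit matrix and the
  Toeplitz matrices are invertible, so definiteness is preserved as well; (b) is (a) for the extended sequence.

  For (d) and (e) the condition $L_n = 0$ is restated without the Moore-Penrose inverse: if
  $H_n \ge 0$, then $L_n = 0$ says that every vector is the last block of a vector in the
  kernel of $H_n$ (lemma \<open>hankel_schur_eq_0_iff\<close>). Kernel vectors are carried over by the congruences above,
  where the compression by $E$ does no harm: $H_n \ge 0$ implies that the kernel of $s_0$ is contained in the kernel
  of $s_j$ for $j < 2n$ (lemma \<open>hankel_dominance\<close>). Only the last matrix of the sequence need not be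
  dominated in this way; it enters nothing but the corner of the Hankel matrix, where it meets the last block of the
  kernel vector, and that block can be chosen in the range of $E$.

  A vector of $\mathbb{C}^q$ is represented by a function \<open>nat \<Rightarrow> complex\<close> of which only the
  values below \<open>q\<close> matter. With pointwise addition these functions form an abelian group as a type, so
  that the manipulation of double sums needs no dimension side conditions.
\<close>

section \<open>Moore-Penrose inverses of Hermitian matrices\<close>

lemma mem_carrier_mat_iff: "A \<in> carrier_mat n m \<longleftrightarrow> dim_row A = n \<and> dim_col A = m"
  by auto

text \<open>
  The rules of matrix arithmetic with conditions on dimensions in place of carrier sets, so that
  conditional rewriting can discharge them.
\<close>

lemma mult_assoc_dims:
  "dim_col A = dim_row B \<Longrightarrow> dim_col B = dim_row C \<Longrightarrow> (A :: 'a :: semiring_0 mat) * B * C = A * (B * C)"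
  by (rule assoc_mult_mat) auto

lemma add_mult_distrib_dims:
  "dim_row A = dim_row B \<Longrightarrow> dim_col A = dim_col B \<Longrightarrow> dim_col B = dim_row C \<Longrightarrow>
    ((A :: 'a :: semiring_0 mat) + B) * C = A * C + B * C"
  by (rule add_mult_distrib_mat) auto

lemma mult_add_distrib_dims:
  "dim_row C = dim_row B \<Longrightarrow> dim_col C = dim_col B \<Longrightarrow> dim_col A = dim_row B \<Longrightarrow>
    (A :: 'a :: semiring_0 mat) * (B + C) = A * B + A * C"
  by (rule mult_add_distrib_mat) auto

lemma one_mult_dims:
  "dim_row A = n \<Longrightarrow> 1\<^sub>m n * (A :: 'a :: semiring_1 mat) = A"
  "dim_col A = n \<Longrightarrow> A * 1\<^sub>m n = A"
  by auto

lemma adjoint_index: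
  "i < dim_col A \<Longrightarrow> j < dim_row A \<Longrightarrow> mat_adjoint A $$ (i, j) = cnj (A $$ (j, i))"
  by (simp add: mat_adjoint_def mat_of_rows_def)

lemma adjoint_dim [simp]:
  "dim_row (mat_adjoint A) = dim_col A" "dim_col (mat_adjoint A) = dim_row A"
  unfolding mat_adjoint_def by simp_all

lemma adjoint_mult:
  fixes A B :: "complex mat"
  assumes "dim_col A = dim_row B"
  shows "mat_adjoint (A * B) = mat_adjoint B * mat_adjoint A"
proof (rule eq_matI)
  fix i j assume "i < dim_row (mat_adjoint B * mat_adjoint A)" "j < dim_col (mat_adjoint B * mat_adjoint A)"
  then have i: "i < dim_col B" and j: "j < dim_row A" by auto
  have "mat_adjoint (A * B) $$ (i, j) = cnj ((A * B) $$ (j, i))"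
    using i j by (intro adjoint_index) auto
  also have "\<dots> = (mat_adjoint B * mat_adjoint A) $$ (i, j)"
    using i j assms by (simp add: scalar_prod_def adjoint_index mult.commute)
  finally show "mat_adjoint (A * B) $$ (i, j) = (mat_adjoint B * mat_adjoint A) $$ (i, j)" .
qed auto

lemma adjoint_add:
  fixes A B :: "complex mat"
  assumes "dim_row A = dim_row B" "dim_col A = dim_col B"
  shows "mat_adjoint (A + B) = mat_adjoint A + mat_adjoint B"
proof (rule eq_matI)
  fix i j assume "i < dim_row (mat_adjoint A + mat_adjoint B)" "j < dim_col (mat_adjoint A + mat_adjoint B)"
  then have i: "i < dim_col B" and j: "j < dim_row B" by auto
  have "mat_adjoint (A + B) $$ (i, j) = cnj ((A + B) $$ (j, i))"
    using i j by (intro adjoint_index) auto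
  then show "mat_adjoint (A + B) $$ (i, j) = (mat_adjoint A + mat_adjoint B) $$ (i, j)"
    using i j assms by (simp add: adjoint_index)
qed (use assms in auto)

lemma adjoint_uminus: "mat_adjoint (- A) = - mat_adjoint (A :: complex mat)"
  by (rule eq_matI) (auto simp: adjoint_index)

lemma adjoint_smult_real:
  assumes "mat_adjoint A = A"
  shows "mat_adjoint (complex_of_real r \<cdot>\<^sub>m A) = complex_of_real r \<cdot>\<^sub>m A"
proof (rule eq_matI)
  have d: "dim_row A = dim_col A" using assms by (metis adjoint_dim(1))
  fix i j assume "i < dim_row (complex_of_real r \<cdot>\<^sub>m A)" "j < dim_col (complex_of_real r \<cdot>\<^sub>m A)"
  then have ij: "i < dim_col A" "j < dim_col A" using d by auto
  have "cnj (A $$ (j, i)) = A $$ (i, j)" using adjoint_index[of i A j] ij d assms by simp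
  then show "mat_adjoint (complex_of_real r \<cdot>\<^sub>m A) $$ (i, j) = (complex_of_real r \<cdot>\<^sub>m A) $$ (i, j)"
    using ij d by (simp add: adjoint_index)
next
  have d: "dim_row A = dim_col A" using assms by (metis adjoint_dim(1))
  then show "dim_row (mat_adjoint (complex_of_real r \<cdot>\<^sub>m A)) = dim_row (complex_of_real r \<cdot>\<^sub>m A)"
    and "dim_col (mat_adjoint (complex_of_real r \<cdot>\<^sub>m A)) = dim_col (complex_of_real r \<cdot>\<^sub>m A)" by simp_all
qed

lemma adjoint_zero [simp]: "mat_adjoint (0\<^sub>m n m) = (0\<^sub>m m n :: complex mat)"
  by (rule eq_matI) (auto simp: adjoint_index)

lemma adjoint_one [simp]: "mat_adjoint (1\<^sub>m n) = (1\<^sub>m n :: complex mat)"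
  by (rule eq_matI) (auto simp: adjoint_index)

text \<open>
  For two Moore-Penrose inverses $X$, $Y$ the products $AX$ and $AY$ are Hermitian idempotents with the same
  range, hence equal; likewise $XA = YA$, and then $X = XAX = YAY = Y$.
\<close>

lemma moore_penrose_unique:
  assumes X: "moore_penrose A X" and Y: "moore_penrose A Y"
  shows "X = Y"
proof -
  have [simp]: "dim_row X = dim_col A" "dim_col X = dim_row A" "dim_row Y = dim_col A" "dim_col Y = dim_row A"
    using X Y by (auto simp: moore_penrose_def)
  have AX: "A * (X * A) = A" "X * (A * X) = X" "mat_adjoint (A * X) = A * X" "mat_adjoint (X * A) = X * A"
    and AY: "A * (Y * A) = A" "Y * (A * Y) = Y" "mat_adjoint (A * Y) = A * Y" "mat_adjoint (Y * A) = Y * A"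
    using X Y by (auto simp: moore_penrose_def mult_assoc_dims)
  have "(A * Y) * (A * X) = (A * (Y * A)) * X" by (simp add: mult_assoc_dims)
  then have "mat_adjoint (A * X) = mat_adjoint ((A * Y) * (A * X))" by (simp add: AY)
  also have "\<dots> = (A * X) * (A * Y)" by (subst adjoint_mult) (simp_all add: AX AY)
  also have "\<dots> = (A * (X * A)) * Y" by (simp add: mult_assoc_dims)
  finally have e1: "A * X = A * Y" using AX by simp
  have "(X * A) * (Y * A) = X * (A * (Y * A))" by (simp add: mult_assoc_dims)
  then have "mat_adjoint (X * A) = mat_adjoint ((X * A) * (Y * A))" by (simp add: AY)
  also have "\<dots> = (Y * A) * (X * A)" by (subst adjoint_mult) (simp_all add: AX AY)
  also have "\<dots> = Y * (A * (X * A))" by (simp add: mult_assoc_dims)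
  finally have e2: "X * A = Y * A" using AX by simp
  have "X = (X * A) * X" using AX by (simp add: mult_assoc_dims)
  also have "\<dots> = Y * (A * X)" by (simp add: e2 mult_assoc_dims)
  also have "\<dots> = Y" by (simp add: e1 AY)
  finally show ?thesis .
qed

lemma pinv_eqI: "moore_penrose A X \<Longrightarrow> pinv A = X"
  unfolding pinv_def by (rule the_equality) (auto intro: moore_penrose_unique)

text \<open>
  The trace of a Hermitian idempotent is its rank. Here it only measures progress when such a
  matrix is enlarged step by step.
\<close>

definition real_trace :: "complex mat \<Rightarrow> real" where
  "real_trace Q = (\<Sum>i<dim_row Q. Re (Q $$ (i, i)))"

text \<open>
  A diagonal entry $a$ of a Hermitian idempotent is the squared norm of its row, so $a^2 \le a$ and thus $a \le 1$.
\<close>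

lemma real_trace_projection_le:
  assumes Q: "Q \<in> carrier_mat n n" and h: "mat_adjoint Q = Q" and id: "Q * Q = Q"
  shows "real_trace Q \<le> real n"
proof -
  have le: "Re (Q $$ (i, i)) \<le> 1" if i: "i < n" for i
  proof -
    have c: "Q $$ (k, i) = cnj (Q $$ (i, k))" if "k < n" for k
      using adjoint_index[of k Q i] h Q i that by simp
    have "Q $$ (i, i) = (\<Sum>k<n. Q $$ (i, k) * Q $$ (k, i))"
      using arg_cong[OF id, of "\<lambda>M. M $$ (i, i)"] Q i
      by (simp add: scalar_prod_def atLeast0LessThan)
    also have "\<dots> = (\<Sum>k<n. complex_of_real ((cmod (Q $$ (i, k)))\<^sup>2))"
      by (intro sum.cong refl) (simp add: c complex_norm_square del: of_real_power)
    also have "\<dots> = complex_of_real (\<Sum>k<n. (cmod (Q $$ (i, k)))\<^sup>2)"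
      by (simp only: of_real_sum)
    finally have e: "Re (Q $$ (i, i)) = (\<Sum>k<n. (cmod (Q $$ (i, k)))\<^sup>2)"
      by (metis Re_complex_of_real)
    have "(Re (Q $$ (i, i)))\<^sup>2 \<le> (cmod (Q $$ (i, i)))\<^sup>2"
      using power_mono[OF abs_Re_le_cmod abs_ge_zero, of "Q $$ (i, i)" 2] by simp
    also have "\<dots> \<le> (\<Sum>k<n. (cmod (Q $$ (i, k)))\<^sup>2)"
      using i by (intro member_le_sum) auto
    finally have "(Re (Q $$ (i, i)))\<^sup>2 \<le> Re (Q $$ (i, i))" using e by simp
    then have "\<not> 1 < Re (Q $$ (i, i))"
      using mult_strict_right_mono[of 1 "Re (Q $$ (i, i))" "Re (Q $$ (i, i))"]
      by (auto simp: power2_eq_square)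
    then show ?thesis by simp
  qed
  have "real_trace Q = (\<Sum>i<n. Re (Q $$ (i, i)))" using Q by (simp add: real_trace_def)
  also have "\<dots> \<le> (\<Sum>i<n. 1)" using le by (intro sum_mono) auto
  finally show ?thesis by simp
qed

text \<open>
  If $A$ is Hermitian and $AQ = 0$, then a null vector $v$ of $A + Q$ is annihilated by $Q$
  (apply $Q$ and use $QA = 0$) and so by $A$. The projection onto the line of $v$ is therefore orthogonal
  to $Q$ and can be added to it.
\<close>

lemma projection_enlarge:
  assumes A: "A \<in> carrier_mat n n" and hA: "mat_adjoint A = A"
    and Q: "Q \<in> carrier_mat n n" and hQ: "mat_adjoint Q = Q" and id: "Q * Q = Q" and AQ: "A * Q = 0\<^sub>m n n"
    and v: "v \<in> carrier_vec n" "v \<noteq> 0\<^sub>v n" "(A + Q) *\<^sub>v v = 0\<^sub>v n"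
  shows "\<exists>Q'. Q' \<in> carrier_mat n n \<and> mat_adjoint Q' = Q' \<and> Q' * Q' = Q' \<and> A * Q' = 0\<^sub>m n n
    \<and> real_trace Q' = real_trace Q + 1"
proof -
  have [simp]: "dim_row A = n" "dim_col A = n" "dim_row Q = n" "dim_col Q = n" "dim_vec v = n"
    using A Q v by auto
  have "mat_adjoint (A * Q) = Q * A" by (simp add: adjoint_mult hA hQ)
  then have QA: "Q * A = 0\<^sub>m n n" using AQ by simp
  have e: "A *\<^sub>v v + Q *\<^sub>v v = 0\<^sub>v n" using v A Q by (simp add: add_mult_distrib_mat_vec[of _ n n])
  have "Q *\<^sub>v v = 0\<^sub>v n"
  proof -
    have "Q *\<^sub>v (A *\<^sub>v v + Q *\<^sub>v v) = (Q * A) *\<^sub>v v + (Q * Q) *\<^sub>v v"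
      using v A Q by (simp add: mult_add_distrib_mat_vec[of _ n n] assoc_mult_mat_vec[of _ n n _ n])
    moreover have "Q *\<^sub>v 0\<^sub>v n = 0\<^sub>v n" by (rule eq_vecI) (auto simp: scalar_prod_def)
    moreover have "0\<^sub>m n n *\<^sub>v v = 0\<^sub>v n" by (rule eq_vecI) (auto simp: scalar_prod_def)
    moreover have "0\<^sub>v n + Q *\<^sub>v v = Q *\<^sub>v v" by (rule eq_vecI) auto
    ultimately show ?thesis unfolding e QA id by (simp only:)
  qed
  then have Qv: "Q *\<^sub>v v = 0\<^sub>v n" .
  have Av: "A *\<^sub>v v = 0\<^sub>v n" 
  proof -
    have "A *\<^sub>v v + 0\<^sub>v n = A *\<^sub>v v" by (rule eq_vecI) auto
    then show ?thesis using e unfolding Qv by (simp only:)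
  qed
  define c where "c = Re (v \<bullet>c v)"
  have c0: "v \<bullet>c v > 0" using conjugate_square_greater_0_vec[OF v(1)] v(2) by simp
  have cv: "v \<bullet>c v = complex_of_real c"
    using c0 unfolding c_def by (intro complex_eqI) (simp_all add: less_complex_def)
  have c: "c > 0" using c0 unfolding c_def by (simp only: less_complex_def zero_complex.sel)
  have cs: "(\<Sum>i<n. v $ i * cnj (v $ i)) = complex_of_real c"
    using cv v by (simp add: scalar_prod_def atLeast0LessThan)
  define R where "R = mat n n (\<lambda>(i, j). v $ i * (cnj (v $ j) / complex_of_real c))"
  have R: "R \<in> carrier_mat n n" and [simp]: "dim_row R = n" "dim_col R = n" by (simp_all add: R_def)
  have hR: "mat_adjoint R = R" by (rule eq_matI) (auto simp: R_def adjoint_index)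
  have MR: "(M * R) $$ (i, j) = (\<Sum>k<n. M $$ (i, k) * v $ k) * (cnj (v $ j) / complex_of_real c)"
    if "M \<in> carrier_mat n n" "i < n" "j < n" for M i j
    using that by (simp add: R_def scalar_prod_def atLeast0LessThan sum_distrib_right mult.assoc
        del: times_divide_eq_right)
  have RR: "R * R = R"
  proof (rule eq_matI)
    fix i j assume "i < dim_row R" "j < dim_col R"
    then have ij: "i < n" "j < n" by auto
    have "(\<Sum>k<n. R $$ (i, k) * v $ k) = (\<Sum>k<n. v $ i / complex_of_real c * (v $ k * cnj (v $ k)))"
      using ij by (intro sum.cong) (auto simp: R_def)
    also have "\<dots> = v $ i / complex_of_real c * complex_of_real c"
      unfolding cs[symmetric] sum_distrib_left ..
    finally show "(R * R) $$ (i, j) = R $$ (i, j)"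
      using c ij R unfolding MR[OF R ij] by (simp add: R_def)
  qed auto
  have MR0: "M * R = 0\<^sub>m n n" if M: "M \<in> carrier_mat n n" "M *\<^sub>v v = 0\<^sub>v n" for M
  proof (rule eq_matI)
    fix i j assume "i < dim_row (0\<^sub>m n n :: complex mat)" "j < dim_col (0\<^sub>m n n :: complex mat)"
    then have ij: "i < n" "j < n" by auto
    have "(\<Sum>k<n. M $$ (i, k) * v $ k) = (M *\<^sub>v v) $ i"
      using ij M(1) by (simp add: scalar_prod_def atLeast0LessThan)
    then show "(M * R) $$ (i, j) = 0\<^sub>m n n $$ (i, j)"
      unfolding MR[OF M(1) ij] M(2) using ij by simp
  qed (use M R in auto)
  have QR: "Q * R = 0\<^sub>m n n" using MR0[OF Q Qv] .
  have RQ: "R * Q = 0\<^sub>m n n"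
  proof -
    have "mat_adjoint (Q * R) = R * Q" by (simp add: adjoint_mult hQ hR)
    then show ?thesis using QR by simp
  qed
  have tr: "real_trace (Q + R) = real_trace Q + 1"
  proof -
    have "(\<Sum>i<n. R $$ (i, i)) = (\<Sum>i<n. v $ i * cnj (v $ i)) / complex_of_real c"
      by (simp add: R_def sum_divide_distrib)
    then have "(\<Sum>i<n. R $$ (i, i)) = 1" using c by (simp add: cs)
    then have "(\<Sum>i<n. Re (R $$ (i, i))) = 1" by (simp flip: Re_sum)
    then show ?thesis by (simp add: real_trace_def sum.distrib)
  qed
  show ?thesis
  proof (intro exI[of _ "Q + R"] conjI)
    show "mat_adjoint (Q + R) = Q + R" by (simp add: adjoint_add hQ hR)
    have "(Q + R) * (Q + R) = (Q + 0\<^sub>m n n) + (0\<^sub>m n n + R)"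
      by (simp add: add_mult_distrib_dims mult_add_distrib_dims QR RQ RR id)
    then show "(Q + R) * (Q + R) = Q + R" using Q R by simp
    have "A * (Q + R) = 0\<^sub>m n n + 0\<^sub>m n n"
      by (simp add: mult_add_distrib_dims AQ MR0[OF A Av])
    then show "A * (Q + R) = 0\<^sub>m n n" by simp
  qed (use R Q tr in auto)
qed

text \<open>
  If every such $Q$ left $A + Q$ singular, then projections in the kernel of $A$ could be enlarged forever,
  against the bound on their trace. In the end $Q$ is the projection onto the whole kernel.
\<close>

lemma hermitian_kernel_projection:
  assumes A: "A \<in> carrier_mat n n" and hA: "mat_adjoint A = (A :: complex mat)"
  shows "\<exists>Q. Q \<in> carrier_mat n n \<and> mat_adjoint Q = Q \<and> A * Q = 0\<^sub>m n n \<and> det (A + Q) \<noteq> 0"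
proof (rule ccontr)
  assume neg: "\<not> ?thesis"
  have "\<exists>Q. Q \<in> carrier_mat n n \<and> mat_adjoint Q = Q \<and> Q * Q = Q \<and> A * Q = 0\<^sub>m n n \<and> real_trace Q = real k" for k
  proof (induction k)
    case 0
    show ?case using A by (intro exI[of _ "0\<^sub>m n n"]) (auto simp: real_trace_def)
  next
    case (Suc k)
    then obtain Q where Q: "Q \<in> carrier_mat n n" "mat_adjoint Q = Q" "Q * Q = Q" "A * Q = 0\<^sub>m n n" "real_trace Q = real k" by blast
    then have "det (A + Q) = 0" using neg by blast
    then obtain v where v: "v \<in> carrier_vec n" "v \<noteq> 0\<^sub>v n" "(A + Q) *\<^sub>v v = 0\<^sub>v n"
      using det_0_iff_vec_prod_zero[of "A + Q" n] A Q by auto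
    show ?case using projection_enlarge[OF A hA Q(1-4) v] Q(5) by (auto simp: add.commute)
  qed
  from this[of "Suc n"] obtain Q where "Q \<in> carrier_mat n n" "mat_adjoint Q = Q" "Q * Q = Q" "real_trace Q = real (Suc n)"
    by blast
  with real_trace_projection_le[of Q n] show False by simp
qed

text \<open>
  With $Q$ as above and $Y = (A + Q)^{-1}$ one has $Y A^2 = A = A^2 Y$, because $AQ = QA = 0$.
  So $A$ and $Y$ commute, and $A Y^2$ is the Moore-Penrose inverse of $A$.
\<close>

lemma hermitian_moore_penrose:
  assumes A: "A \<in> carrier_mat n n" and hA: "mat_adjoint A = A"
  shows "\<exists>X. moore_penrose A X \<and> A * X = X * A"
proof -
  obtain Q where Q: "Q \<in> carrier_mat n n" "mat_adjoint Q = Q" "A * Q = 0\<^sub>m n n" "det (A + Q) \<noteq> 0"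
    using hermitian_kernel_projection[OF A hA] by blast
  define M where "M = A + Q"
  have M: "M \<in> carrier_mat n n" using A Q by (simp add: M_def)
  obtain Y where Y: "Y \<in> carrier_mat n n" "Y * M = 1\<^sub>m n" "M * Y = 1\<^sub>m n"
  proof -
    have "det M \<noteq> 0" using Q(4) by (simp add: M_def)
    from det_non_zero_imp_unit[OF M this, of "()"] show thesis
      using that by (auto simp: Units_def ring_mat_def)
  qed
  have [simp]: "dim_row A = n" "dim_col A = n" "dim_row Q = n" "dim_col Q = n"
    "dim_row M = n" "dim_col M = n" "dim_row Y = n" "dim_col Y = n"
    using A Q M Y by auto
  have AA: "A * A \<in> carrier_mat n n" using A by auto
  have AM: "A * M = A * A" using AA by (simp add: M_def mult_add_distrib_dims Q)
  have "mat_adjoint (A * Q) = Q * A" by (simp add: adjoint_mult hA Q(2))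
  then have QA: "Q * A = 0\<^sub>m n n" unfolding Q(3) by simp
  have MA: "M * A = A * A" using AA by (simp add: M_def add_mult_distrib_dims QA)
  have YAA: "Y * (A * A) = A"
  proof -
    have "Y * (M * A) = (Y * M) * A" by (simp add: mult_assoc_dims)
    then show ?thesis using Y A MA by simp
  qed
  have AAY: "A * (A * Y) = A"
  proof -
    have "(A * M) * Y = A * (M * Y)" by (simp add: mult_assoc_dims)
    then show ?thesis using Y A AM by (simp add: mult_assoc_dims)
  qed
  have c: "Y * A = A * Y"
  proof -
    have "Y * A = Y * (A * (A * Y))" by (simp add: AAY)
    also have "\<dots> = (Y * (A * A)) * Y" by (simp add: mult_assoc_dims)
    finally show ?thesis by (simp add: YAA)
  qed
  have hY: "mat_adjoint Y = Y"
  proof -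
    have hM: "mat_adjoint M = M" unfolding M_def by (simp add: adjoint_add hA Q)
    have "mat_adjoint (M * Y) = mat_adjoint Y * M" by (simp add: adjoint_mult hM)
    then have l: "mat_adjoint Y * M = 1\<^sub>m n" using Y by simp
    have "(mat_adjoint Y * M) * Y = mat_adjoint Y * (M * Y)" by (simp add: mult_assoc_dims)
    then show ?thesis using l Y by (simp add: one_mult_dims)
  qed
  define X where "X = A * (Y * Y)"
  have [simp]: "dim_row X = n" "dim_col X = n" by (simp_all add: X_def)
  have X: "X \<in> carrier_mat n n" by (intro carrier_matI) simp_all
  have AX: "A * X = A * Y"
  proof -
    have "A * X = (A * (A * Y)) * Y" by (simp add: X_def mult_assoc_dims)
    then show ?thesis by (simp add: AAY)
  qed
  have XA: "X * A = A * Y"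
  proof -
    have "X * A = A * (Y * (Y * A))" by (simp add: X_def mult_assoc_dims)
    also have "\<dots> = A * (Y * (A * Y))" unfolding c ..
    also have "\<dots> = A * ((Y * A) * Y)" by (simp add: mult_assoc_dims)
    also have "\<dots> = A * X" unfolding c by (simp add: X_def mult_assoc_dims)
    finally show ?thesis using AX by simp
  qed
  have hYA: "mat_adjoint (A * Y) = A * Y" by (simp add: adjoint_mult hA hY c)
  have "moore_penrose A X" unfolding moore_penrose_def
  proof (intro conjI)
    show "X \<in> carrier_mat (dim_col A) (dim_row A)" using X by simp
    show "A * X * A = A" unfolding AX by (simp add: mult_assoc_dims c AAY)
    have "X * A * X = X * (A * Y)" by (simp add: mult_assoc_dims AX)
    also have "\<dots> = (X * A) * Y" by (simp add: mult_assoc_dims)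
    also have "\<dots> = X" unfolding XA by (simp add: X_def mult_assoc_dims)
    finally show "X * A * X = X" .
  qed (simp_all add: AX XA hYA)
  then show ?thesis using AX XA by (intro exI[of _ X]) simp
qed

lemma pinv_hermitian:
  assumes A: "A \<in> carrier_mat n n" and hA: "mat_adjoint A = A"
  shows "pinv A \<in> carrier_mat n n" "A * pinv A * A = A" "pinv A * A * pinv A = pinv A"
    "pinv A * A = A * pinv A" "mat_adjoint (A * pinv A) = A * pinv A" "mat_adjoint (pinv A) = pinv A"
proof -
  obtain X where X: "moore_penrose A X" "A * X = X * A" using hermitian_moore_penrose[OF A hA] by blast
  have p: "pinv A = X" by (rule pinv_eqI[OF X(1)])
  show "A * pinv A * A = A" "pinv A * A * pinv A = pinv A" "mat_adjoint (A * pinv A) = A * pinv A"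
    unfolding p using X(1) unfolding moore_penrose_def by blast+
  show "pinv A * A = A * pinv A" unfolding p by (rule X(2)[symmetric])
  have [simp]: "dim_row A = n" "dim_col A = n" using A by simp_all
  have Xc: "X \<in> carrier_mat n n" using X(1) by (simp add: moore_penrose_def)
  then show "pinv A \<in> carrier_mat n n" unfolding p .
  have [simp]: "dim_row X = n" "dim_col X = n" using Xc by simp_all
  have X1: "mat_adjoint (X * A) = X * A" "mat_adjoint (A * X) = A * X"
    using X(1) unfolding moore_penrose_def by blast+
  have a1: "A * mat_adjoint X = X * A" using X1(1) by (simp add: adjoint_mult hA)
  have a2: "mat_adjoint X * A = A * X" using X1(2) by (simp add: adjoint_mult hA)
  have "moore_penrose A (mat_adjoint X)" unfolding moore_penrose_def
  proof (intro conjI)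
    show "mat_adjoint X \<in> carrier_mat (dim_col A) (dim_row A)" by (simp add: mem_carrier_mat_iff)
    show "A * mat_adjoint X * A = A" unfolding a1 X(2)[symmetric]
      using X(1) unfolding moore_penrose_def by blast
    show "mat_adjoint (A * mat_adjoint X) = A * mat_adjoint X" "mat_adjoint (mat_adjoint X * A) = mat_adjoint X * A"
      unfolding a1 a2 X1 by (rule refl)+
    have "mat_adjoint (X * A * X) = mat_adjoint X * (A * mat_adjoint X)"
      by (simp add: adjoint_mult hA)
    moreover have "X * A * X = X" using X(1) unfolding moore_penrose_def by blast
    ultimately show "mat_adjoint X * A * mat_adjoint X = mat_adjoint X"
      by (simp add: mult_assoc_dims)
  qed
  then show "mat_adjoint (pinv A) = pinv A" unfolding p using pinv_eqI p by metis
qed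

section \<open>Matrices as operators and nonnegative Hermitian forms\<close>

text \<open>
  The result is zero outside the range of row indices; two images under \<open>act\<close> are equal
  as functions as soon as their relevant coordinates agree.
\<close>

definition act :: "complex mat \<Rightarrow> (nat \<Rightarrow> complex) \<Rightarrow> nat \<Rightarrow> complex" where
  "act A x = (\<lambda>i. if i < dim_row A then \<Sum>k<dim_col A. A $$ (i, k) * x k else 0)"

definition ip :: "nat \<Rightarrow> (nat \<Rightarrow> complex) \<Rightarrow> (nat \<Rightarrow> complex) \<Rightarrow> complex" where
  "ip n x y = (\<Sum>i<n. x i * cnj (y i))"

lemma sum_fun_apply: "(\<Sum>i\<in>I. f i) x = (\<Sum>i\<in>I. f i x)"
  for f :: "'i \<Rightarrow> 'a \<Rightarrow> 'b :: comm_monoid_add"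
  by (induction I rule: infinite_finite_induct) (auto simp: zero_fun_def)

lemma act_add: "act A (x + y) = act A x + act A y"
  by (rule ext) (simp add: act_def algebra_simps sum.distrib)

lemma act_zero [simp]: "act A 0 = 0"
  by (rule ext) (simp add: act_def)

lemma act_uminus: "act A (- x) = - act A x"
  by (rule ext) (simp add: act_def sum_negf)

lemma act_diff: "act A (x - y) = act A x - act A y"
  by (rule ext) (simp add: act_def algebra_simps sum_subtractf)

lemma act_sum: "act A (\<Sum>i\<in>I. f i) = (\<Sum>i\<in>I. act A (f i))"
  by (rule additive.sum[of "act A"]) (unfold_locales, rule act_add)

lemma act_mult:
  assumes "dim_col A = dim_row B"
  shows "act (A * B) x = act A (act B x)"
proof (rule ext)
  fix i
  have "(\<Sum>k<dim_col B. (\<Sum>l<dim_row B. A $$ (i, l) * B $$ (l, k)) * x k)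
      = (\<Sum>l<dim_row B. A $$ (i, l) * (\<Sum>k<dim_col B. B $$ (l, k) * x k))"
    unfolding sum_distrib_left sum_distrib_right by (subst sum.swap) (simp add: mult.assoc)
  then show "act (A * B) x i = act A (act B x) i"
    using assms by (simp add: act_def scalar_prod_def atLeast0LessThan)
qed

lemma act_plus_mat:
  "dim_row A = dim_row B \<Longrightarrow> dim_col A = dim_col B \<Longrightarrow> act (A + B) x = act A x + act B x"
  by (rule ext) (simp add: act_def algebra_simps sum.distrib)

lemma act_minus_mat:
  "dim_row A = dim_row B \<Longrightarrow> dim_col A = dim_col B \<Longrightarrow> act (A - B) x = act A x - act B x"
  by (rule ext) (simp add: act_def algebra_simps sum_subtractf)

lemma act_uminus_mat: "act (- A) x = - act A x"
  by (rule ext) (simp add: act_def sum_negf)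

lemma act_smult_mat: "act (c \<cdot>\<^sub>m A) x = (\<lambda>i. c * act A x i)"
  by (rule ext) (simp add: act_def sum_distrib_left mult.assoc)

lemma act_zero_mat [simp]: "act (0\<^sub>m n m) x = 0"
  by (rule ext) (simp add: act_def)

lemma act_mat_sum:
  assumes "\<And>l. l \<in> I \<Longrightarrow> f l \<in> carrier_mat n m"
  shows "act (mat_sum n m f I) x = (\<Sum>l\<in>I. act (f l) x)"
proof (rule ext)
  fix i
  have "(\<Sum>k<m. (\<Sum>l\<in>I. f l $$ (i, k)) * x k) = (\<Sum>l\<in>I. \<Sum>k<m. f l $$ (i, k) * x k)"
    unfolding sum_distrib_right by (rule sum.swap)
  moreover have "(\<Sum>l\<in>I. act (f l) x i) = (\<Sum>l\<in>I. if i < n then \<Sum>k<m. f l $$ (i, k) * x k else 0)"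
    using assms by (intro sum.cong) (auto simp: act_def)
  ultimately show "act (mat_sum n m f I) x i = (\<Sum>l\<in>I. act (f l) x) i"
    by (simp add: act_def mat_sum_def sum_fun_apply)
qed

lemma act_outside: "dim_row A \<le> i \<Longrightarrow> act A x i = 0"
  by (simp add: act_def)

lemma act_cong: "(\<And>i. i < dim_col A \<Longrightarrow> x i = y i) \<Longrightarrow> act A x = act A y"
  by (rule ext) (simp add: act_def)

lemma mat_eqI_act:
  assumes "A \<in> carrier_mat n m" "B \<in> carrier_mat n m" "\<And>x. act A x = act B x"
  shows "A = B"
proof (rule eq_matI)
  fix i j assume "i < dim_row B" "j < dim_col B"
  then have ij: "i < n" "j < m" using assms by auto
  have "act C (\<lambda>k. if k = j then 1 else 0) i = C $$ (i, j)" if "C \<in> carrier_mat n m" for C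
    using that ij by (simp add: act_def if_distrib [of "\<lambda>z. _ * z"] cong: if_cong)
  then show "A $$ (i, j) = B $$ (i, j)" using assms by metis
qed (use assms in auto)

lemma ip_add_left: "ip n (x + y) z = ip n x z + ip n y z"
  by (simp add: ip_def algebra_simps sum.distrib)

lemma ip_diff_left: "ip n (x - y) z = ip n x z - ip n y z"
  by (simp add: ip_def algebra_simps sum_subtractf)

lemma ip_diff_right: "ip n z (x - y) = ip n z x - ip n z y"
  by (simp add: ip_def algebra_simps sum_subtractf)

lemma ip_zero [simp]: "ip n 0 x = 0" "ip n x 0 = 0"
  by (simp_all add: ip_def)

lemma ip_sum_left: "ip n (\<Sum>i\<in>I. f i) z = (\<Sum>i\<in>I. ip n (f i) z)"
  by (rule additive.sum[of "\<lambda>x. ip n x z"]) (unfold_locales, rule ip_add_left)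

lemma ip_add_right: "ip n z (x + y) = ip n z x + ip n z y"
  by (simp add: ip_def algebra_simps sum.distrib)

lemma ip_sum_right: "ip n z (\<Sum>i\<in>I. f i) = (\<Sum>i\<in>I. ip n z (f i))"
  by (rule additive.sum[of "ip n z"]) (unfold_locales, rule ip_add_right)

lemma ip_self: "ip n x x = complex_of_real (\<Sum>i<n. (cmod (x i))\<^sup>2)"
  unfolding ip_def of_real_sum complex_norm_square ..

lemma ip_self_eq_0: "ip n x x = 0 \<Longrightarrow> i < n \<Longrightarrow> x i = 0"
  unfolding ip_self of_real_eq_0_iff by (subst (asm) sum_nonneg_eq_0_iff) auto

lemma ip_adjoint:
  assumes "A \<in> carrier_mat n m"
  shows "ip n (act A x) y = ip m x (act (mat_adjoint A) y)"
proof -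
  have "ip n (act A x) y = (\<Sum>i<n. \<Sum>k<m. A $$ (i, k) * x k * cnj (y i))"
    using assms by (simp add: ip_def act_def sum_distrib_right)
  also have "\<dots> = (\<Sum>k<m. \<Sum>i<n. A $$ (i, k) * x k * cnj (y i))" by (rule sum.swap)
  also have "\<dots> = ip m x (act (mat_adjoint A) y)"
    using assms by (simp add: ip_def act_def sum_distrib_left adjoint_index mult_ac)
  finally show ?thesis .
qed

lemma ip_hermitian:
  "A \<in> carrier_mat n n \<Longrightarrow> mat_adjoint A = A \<Longrightarrow> ip n (act A x) y = ip n x (act A y)"
  using ip_adjoint[of A n n x y] by simp

lemma cscalar_prod_act:
  assumes "A \<in> carrier_mat n n"
  shows "(A *\<^sub>v vec n x) \<bullet>c vec n x = ip n (act A x) x"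
  using assms by (simp add: scalar_prod_def ip_def act_def atLeast0LessThan)

lemma nonneg_hermitian_iff:
  assumes A: "A \<in> carrier_mat n n"
  shows "nonneg_hermitian A \<longleftrightarrow> mat_adjoint A = A \<and> (\<forall>x. 0 \<le> ip n (act A x) x)"
proof -
  have "(\<forall>x \<in> carrier_vec n. 0 \<le> (A *\<^sub>v x) \<bullet>c x) \<longleftrightarrow> (\<forall>x. 0 \<le> ip n (act A x) x)" (is "?L \<longleftrightarrow> ?R")
  proof
    assume ?L
    then show ?R by (metis cscalar_prod_act[OF A] vec_carrier)
  next
    assume R: ?R
    show ?L
    proof
      fix x :: "complex vec" assume "x \<in> carrier_vec n"
      then have "x = vec n (\<lambda>i. x $ i)" by auto
      then show "0 \<le> (A *\<^sub>v x) \<bullet>c x" by (metis cscalar_prod_act[OF A] R)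
    qed
  qed
  then show ?thesis using A by (simp add: nonneg_hermitian_def)
qed

lemma pos_hermitian_iff:
  assumes A: "A \<in> carrier_mat n n"
  shows "pos_hermitian A \<longleftrightarrow> mat_adjoint A = A \<and> (\<forall>x. (\<exists>i<n. x i \<noteq> 0) \<longrightarrow> 0 < ip n (act A x) x)"
proof -
  have "(\<forall>x \<in> carrier_vec n. x \<noteq> 0\<^sub>v n \<longrightarrow> 0 < (A *\<^sub>v x) \<bullet>c x)
    \<longleftrightarrow> (\<forall>x. (\<exists>i<n. x i \<noteq> 0) \<longrightarrow> 0 < ip n (act A x) x)" (is "?L \<longleftrightarrow> ?R")
  proof
    assume L: ?L
    show ?R
    proof (intro allI impI)
      fix x :: "nat \<Rightarrow> complex" assume "\<exists>i<n. x i \<noteq> 0"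
      then have "vec n x \<noteq> 0\<^sub>v n" by (metis index_vec index_zero_vec(1))
      then show "0 < ip n (act A x) x" using L by (metis cscalar_prod_act[OF A] vec_carrier)
    qed
  next
    assume R: ?R
    show ?L
    proof (intro ballI impI)
      fix x :: "complex vec" assume x: "x \<in> carrier_vec n" "x \<noteq> 0\<^sub>v n"
      then have e: "x = vec n (\<lambda>i. x $ i)" by auto
      have "\<exists>i<n. x $ i \<noteq> 0" using x by (metis carrier_vecD eq_vecI index_zero_vec)
      then show "0 < (A *\<^sub>v x) \<bullet>c x" by (metis cscalar_prod_act[OF A] R e)
    qed
  qed
  then show ?thesis using A by (simp add: pos_hermitian_def)
qed

text \<open>
  For $v = Ax$ the form at $x - tv$ equals $-2t \|v\|^2 + t^2 \langle Av, v\rangle$, which is negative for small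
  $t > 0$ unless $v = 0$.
\<close>

lemma nonneg_hermitian_kernel:
  assumes A: "A \<in> carrier_mat n n" and nn: "nonneg_hermitian A" and z: "ip n (act A x) x = 0"
  shows "act A x = 0"
proof -
  have h: "mat_adjoint A = A" and pos: "\<And>x. 0 \<le> ip n (act A x) x"
    using nn nonneg_hermitian_iff[OF A] by auto
  define v where "v = act A x"
  define N where "N = (\<Sum>i<n. (cmod (v i))\<^sup>2)"
  define K where "K = Re (ip n (act A v) v)"
  have N: "ip n v v = complex_of_real N" by (simp add: N_def ip_self)
  have N0: "N \<ge> 0" by (simp add: N_def sum_nonneg)
  have xv: "ip n (act A v) x = ip n v v" using ip_hermitian[OF A h, of v x] by (simp add: v_def)
  have q: "0 \<le> - 2 * t * N + t\<^sup>2 * K" for t :: real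
  proof -
    define w where "w = (\<lambda>i. complex_of_real t * v i)"
    have Aw: "act A w = (\<lambda>i. complex_of_real t * act A v i)"
      by (rule ext) (simp add: act_def w_def sum_distrib_left mult_ac)
    have l: "ip n (\<lambda>i. complex_of_real t * a i) b = complex_of_real t * ip n a b"
      and r: "ip n b (\<lambda>i. complex_of_real t * a i) = complex_of_real t * ip n b a" for a b
      by (simp_all add: ip_def sum_distrib_left mult_ac)
    have "ip n (act A (x - w)) (x - w) = ip n (act A x) x - ip n (act A x) w - ip n (act A w) x + ip n (act A w) w"
      by (simp add: act_diff ip_diff_left ip_diff_right)
    also have "\<dots> = - 2 * complex_of_real t * complex_of_real N + (complex_of_real t)\<^sup>2 * ip n (act A v) v"
      unfolding Aw l z unfolding w_def r xv v_def[symmetric] N by (simp add: power2_eq_square)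
    finally have "Re (ip n (act A (x - w)) (x - w)) = - 2 * t * N + t\<^sup>2 * K"
      by (simp add: K_def Re_power2)
    then show ?thesis using pos[of "x - w"] by (simp add: less_eq_complex_def)
  qed
  have "N = 0"
  proof (rule ccontr)
    assume "N \<noteq> 0"
    with N0 have Np: "N > 0" by simp
    \<comment> \<open>small enough for \<open>t * K \<le> N\<close>\<close>
    define t where "t = N / (\<bar>K\<bar> + 1)"
    have t: "t > 0" using Np by (simp add: t_def)
    have "t * K \<le> t * (\<bar>K\<bar> + 1)" using t by (intro mult_left_mono) auto
    also have "\<dots> = N" by (simp add: t_def)
    finally have "t * (t * K) \<le> t * N" using t by (intro mult_left_mono) auto
    moreover have "0 < t * N" using t Np by simp
    ultimately show False using q[of t] by (simp add: power2_eq_square algebra_simps)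
  qed
  then have vv: "ip n v v = 0" using N by simp
  show ?thesis
  proof (rule ext)
    fix i
    show "act A x i = 0 i"
      using ip_self_eq_0[OF vv, of i] act_outside[of A i x] A by (cases "i < n") (auto simp: v_def)
  qed
qed

section \<open>Block Hankel matrices and their forms\<close>

definition flat :: "nat \<Rightarrow> nat \<Rightarrow> (nat \<Rightarrow> nat \<Rightarrow> complex) \<Rightarrow> nat \<Rightarrow> complex" where
  "flat q m x = (\<lambda>a. if a < m * q then x (a div q) (a mod q) else 0)"

definition block :: "nat \<Rightarrow> (nat \<Rightarrow> complex) \<Rightarrow> nat \<Rightarrow> nat \<Rightarrow> complex" where
  "block q X j = (\<lambda>i. if i < q then X (j * q + i) else 0)"

lemma flat_block: "a < m * q \<Longrightarrow> flat q m (block q X) a = X a"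
  by (cases "q = 0") (simp_all add: flat_def block_def)

lemma block_index_less: "j < m \<Longrightarrow> i < q \<Longrightarrow> j * q + i < m * (q :: nat)"
  by (metis Suc_leI add.commute add_less_cancel_left less_le_trans mult_Suc mult_le_mono1)

lemma flat_index: "j < m \<Longrightarrow> i < q \<Longrightarrow> flat q m x (j * q + i) = x j i"
  using block_index_less[of j m i q] by (simp add: flat_def)

lemma sum_block: "(\<Sum>a<m * q. f a) = (\<Sum>j<m. \<Sum>i<q. f (j * q + i))"
  for f :: "nat \<Rightarrow> 'a :: comm_monoid_add"
proof -
  have "(\<Sum>j<m. \<Sum>i<q. f (j * q + i)) = (\<Sum>j<m. sum f {j * q..<j * q + q})"
  proof (rule sum.cong)
    fix j
    have "sum f {0 + j * q..<q + j * q} = (\<Sum>i\<in>{0..<q}. f (i + j * q))" by (rule sum.shift_bounds_nat_ivl)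
    then show "(\<Sum>i<q. f (j * q + i)) = sum f {j * q..<j * q + q}"
      by (simp add: atLeast0LessThan add.commute)
  qed simp
  then show ?thesis by (simp add: sum.nat_group)
qed

lemma ip_flat: "ip (m * q) (flat q m x) (flat q m y) = (\<Sum>j<m. ip q (x j) (y j))"
  unfolding ip_def sum_block by (intro sum.cong) (auto simp: flat_index)

lemma act_block_matrix:
  assumes B: "\<And>j k. j < m \<Longrightarrow> k < n \<Longrightarrow> B j k \<in> carrier_mat q q"
  shows "act (block_matrix q m n B) (flat q n x) = flat q m (\<lambda>j. \<Sum>k<n. act (B j k) (x k))"
proof (rule ext)
  fix a
  show "act (block_matrix q m n B) (flat q n x) a = flat q m (\<lambda>j. \<Sum>k<n. act (B j k) (x k)) a"
  proof (cases "a < m * q")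
    case True
    then have q: "q > 0" by (cases q) auto
    have aq: "a div q < m" "a mod q < q" using True q by (auto simp: less_mult_imp_div_less)
    have "act (block_matrix q m n B) (flat q n x) a
        = (\<Sum>b<n * q. B (a div q) (b div q) $$ (a mod q, b mod q) * flat q n x b)"
      using True by (simp add: act_def block_matrix_def)
    also have "\<dots> = (\<Sum>k<n. \<Sum>i<q. B (a div q) k $$ (a mod q, i) * x k i)"
      unfolding sum_block by (intro sum.cong) (auto simp: flat_index)
    also have "\<dots> = (\<Sum>k<n. act (B (a div q) k) (x k) (a mod q))"
    proof (rule sum.cong)
      fix k assume "k \<in> {..<n}"
      then have "B (a div q) k \<in> carrier_mat q q" using B aq by auto
      then show "(\<Sum>i<q. B (a div q) k $$ (a mod q, i) * x k i) = act (B (a div q) k) (x k) (a mod q)"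
        using aq by (simp add: act_def)
    qed simp
    finally show ?thesis using True by (simp add: flat_def sum_fun_apply)
  next
    case False
    then show ?thesis by (simp add: act_def block_matrix_def flat_def)
  qed
qed

text \<open>
  The $j$-th block of the image of the stacked vector $x$ under the block Hankel matrix of the
  operators $F_i$; \<open>hankel_form\<close> is the associated quadratic form.
\<close>

definition hankel_apply :: "(nat \<Rightarrow> 'v \<Rightarrow> 'v :: comm_monoid_add) \<Rightarrow> nat \<Rightarrow> (nat \<Rightarrow> 'v) \<Rightarrow> nat \<Rightarrow> 'v" where
  "hankel_apply F n x j = (\<Sum>k\<le>n. F (j + k) (x k))"

definition hankel_form :: "nat \<Rightarrow> (nat \<Rightarrow> (nat \<Rightarrow> complex) \<Rightarrow> nat \<Rightarrow> complex) \<Rightarrow> nat \<Rightarrow> (nat \<Rightarrow> nat \<Rightarrow> complex) \<Rightarrow> complex" where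
  "hankel_form q F n x = (\<Sum>j\<le>n. ip q (hankel_apply F n x j) (x j))"

lemma block_hankel_carrier [simp]: "block_hankel q s n \<in> carrier_mat (Suc n * q) (Suc n * q)"
  by (simp add: block_hankel_def block_matrix_def)

lemma act_block_hankel:
  assumes "\<forall>i\<le>2 * n. s i \<in> carrier_mat q q"
  shows "act (block_hankel q s n) (flat q (Suc n) x) = flat q (Suc n) (hankel_apply (\<lambda>i. act (s i)) n x)"
  unfolding block_hankel_def Suc_eq_plus1[symmetric]
  by (subst act_block_matrix) (use assms in \<open>auto simp: hankel_apply_def[abs_def] lessThan_Suc_atMost\<close>)

lemma hankel_form_flat:
  assumes "\<forall>i\<le>2 * n. s i \<in> carrier_mat q q"
  shows "ip (Suc n * q) (act (block_hankel q s n) (flat q (Suc n) x)) (flat q (Suc n) x)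
    = hankel_form q (\<lambda>i. act (s i)) n x"
  by (subst act_block_hankel[OF assms]) (simp_all only: ip_flat hankel_form_def lessThan_Suc_atMost)

lemma block_hankel_hermitian_iff:
  assumes s: "\<forall>i\<le>2 * n. s i \<in> carrier_mat q q"
  shows "mat_adjoint (block_hankel q s n) = block_hankel q s n \<longleftrightarrow> (\<forall>i\<le>2 * n. mat_adjoint (s i) = s i)"
proof
  assume h: "mat_adjoint (block_hankel q s n) = block_hankel q s n"
  show "\<forall>i\<le>2 * n. mat_adjoint (s i) = s i"
  proof (intro allI impI)
    fix i assume i: "i \<le> 2 * n"
    define j where "j = min i n"
    define k where "k = i - j"
    have jk: "j + k = i" "j < Suc n" "k < Suc n" using i by (auto simp: j_def k_def)
    show "mat_adjoint (s i) = s i"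
    proof (rule eq_matI)
      fix a b assume "a < dim_row (s i)" "b < dim_col (s i)"
      then have ab: "a < q" "b < q" using s[rule_format, OF i] by auto
      have l: "k * q + a < Suc n * q" "j * q + b < Suc n * q"
        using block_index_less jk ab by blast+
      have "mat_adjoint (block_hankel q s n) $$ (k * q + a, j * q + b)
          = cnj (block_hankel q s n $$ (j * q + b, k * q + a))"
        by (rule adjoint_index) (use l in \<open>simp_all add: block_hankel_def block_matrix_def\<close>)
      then have "block_hankel q s n $$ (k * q + a, j * q + b) = cnj (block_hankel q s n $$ (j * q + b, k * q + a))"
        unfolding h .
      then have "s i $$ (a, b) = cnj (s i $$ (b, a))"
        using l ab jk by (simp add: block_hankel_def block_matrix_def add.commute[of k j])
      then show "mat_adjoint (s i) $$ (a, b) = s i $$ (a, b)"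
        using ab s[rule_format, OF i] by (simp add: adjoint_index)
    qed (use s[rule_format, OF i] in auto)
  qed
next
  assume h: "\<forall>i\<le>2 * n. mat_adjoint (s i) = s i"
  show "mat_adjoint (block_hankel q s n) = block_hankel q s n"
  proof (rule eq_matI)
    fix a b assume "a < dim_row (block_hankel q s n)" "b < dim_col (block_hankel q s n)"
    then have ab: "a < Suc n * q" "b < Suc n * q" by (auto simp: block_hankel_def block_matrix_def)
    then have q: "q > 0" by (cases q) auto
    have d: "a div q < Suc n" "b div q < Suc n" using ab by (auto simp: less_mult_imp_div_less simp del: mult_Suc)
    let ?i = "a div q + b div q"
    have i: "?i \<le> 2 * n" using d by simp
    have "mat_adjoint (s ?i) $$ (a mod q, b mod q) = cnj (s ?i $$ (b mod q, a mod q))"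
      using s[rule_format, OF i] q by (intro adjoint_index) auto
    then have e: "cnj (s ?i $$ (b mod q, a mod q)) = s ?i $$ (a mod q, b mod q)" using h i by simp
    have "mat_adjoint (block_hankel q s n) $$ (a, b) = cnj (block_hankel q s n $$ (b, a))"
      by (rule adjoint_index) (use ab in \<open>simp_all add: block_hankel_def block_matrix_def\<close>)
    also have "\<dots> = block_hankel q s n $$ (a, b)"
      using ab e by (simp add: block_hankel_def block_matrix_def add.commute)
    finally show "mat_adjoint (block_hankel q s n) $$ (a, b) = block_hankel q s n $$ (a, b)" .
  qed (auto simp: block_hankel_def block_matrix_def)
qed

lemma ip_cong: "(\<And>i. i < n \<Longrightarrow> x i = x' i) \<Longrightarrow> (\<And>i. i < n \<Longrightarrow> y i = y' i) \<Longrightarrow> ip n x y = ip n x' y'"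
  by (simp add: ip_def)

text \<open>
  The Hankel conditions of the classes, freed from block indices.
\<close>

lemma nonneg_block_hankel_iff:
  assumes s: "\<forall>i\<le>2 * n. s i \<in> carrier_mat q q"
  shows "nonneg_hermitian (block_hankel q s n) \<longleftrightarrow>
    (\<forall>i\<le>2 * n. mat_adjoint (s i) = s i) \<and> (\<forall>x. 0 \<le> hankel_form q (\<lambda>i. act (s i)) n x)"
proof -
  let ?H = "block_hankel q s n" and ?N = "Suc n * q"
  note hf = hankel_form_flat[OF s]
  have c: "?H \<in> carrier_mat ?N ?N" by (rule block_hankel_carrier)
  note herm = block_hankel_hermitian_iff[OF s]
  have "(\<forall>X. 0 \<le> ip ?N (act ?H X) X) \<longleftrightarrow> (\<forall>x. 0 \<le> hankel_form q (\<lambda>i. act (s i)) n x)" (is "?L \<longleftrightarrow> ?R")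
  proof
    assume ?L
    then show ?R unfolding hf[symmetric] by blast
  next
    assume R: ?R
    show ?L
    proof
      fix X
      have e: "\<And>a. a < ?N \<Longrightarrow> flat q (Suc n) (block q X) a = X a" by (rule flat_block)
      have "act ?H (flat q (Suc n) (block q X)) = act ?H X"
        by (rule act_cong) (use e in \<open>simp add: block_hankel_def block_matrix_def\<close>)
      then have "ip ?N (act ?H X) X = ip ?N (act ?H (flat q (Suc n) (block q X))) (flat q (Suc n) (block q X))"
        using e by (auto intro: ip_cong)
      then show "0 \<le> ip ?N (act ?H X) X" using R unfolding hf by (simp only:)
    qed
  qed
  then show ?thesis

    by (simp only: nonneg_hermitian_iff[OF c] herm)
qed

lemma pos_block_hankel_iff:
  assumes s: "\<forall>i\<le>2 * n. s i \<in> carrier_mat q q"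
  shows "pos_hermitian (block_hankel q s n) \<longleftrightarrow>
    (\<forall>i\<le>2 * n. mat_adjoint (s i) = s i) \<and>
    (\<forall>x. (\<exists>j\<le>n. \<exists>i<q. x j i \<noteq> 0) \<longrightarrow> 0 < hankel_form q (\<lambda>i. act (s i)) n x)"
proof -
  let ?H = "block_hankel q s n" and ?N = "Suc n * q"
  note hf = hankel_form_flat[OF s]
  have c: "?H \<in> carrier_mat ?N ?N" by (rule block_hankel_carrier)
  note herm = block_hankel_hermitian_iff[OF s]
  have "(\<forall>X. (\<exists>a<?N. X a \<noteq> 0) \<longrightarrow> 0 < ip ?N (act ?H X) X)
    \<longleftrightarrow> (\<forall>x. (\<exists>j\<le>n. \<exists>i<q. x j i \<noteq> 0) \<longrightarrow> 0 < hankel_form q (\<lambda>i. act (s i)) n x)" (is "?L \<longleftrightarrow> ?R")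
  proof
    assume L: ?L
    show ?R
    proof (intro allI impI)
      fix x :: "nat \<Rightarrow> nat \<Rightarrow> complex" assume "\<exists>j\<le>n. \<exists>i<q. x j i \<noteq> 0"
      then obtain j i where ji: "j < Suc n" "i < q" "x j i \<noteq> 0" by (auto simp: less_Suc_eq_le)
      have "\<exists>a<?N. flat q (Suc n) x a \<noteq> 0"
        using block_index_less[OF ji(1,2)] flat_index[OF ji(1,2), of x] ji(3) by (intro exI[of _ "j * q + i"]) simp
      then show "0 < hankel_form q (\<lambda>i. act (s i)) n x" 
        using L unfolding hf[symmetric] by blast
    qed
  next
    assume R: ?R
    show ?L
    proof (intro allI impI)
      fix X :: "nat \<Rightarrow> complex" assume "\<exists>a<?N. X a \<noteq> 0"
      then obtain a where a: "a < ?N" "X a \<noteq> 0" by blast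
      have e: "\<And>a. a < ?N \<Longrightarrow> flat q (Suc n) (block q X) a = X a" by (rule flat_block)
      have q: "q > 0" using a by (cases q) auto
      have "a div q < Suc n" using a(1) by (auto simp: less_mult_imp_div_less simp del: mult_Suc)
      then have "a div q \<le> n" "a mod q < q" "block q X (a div q) (a mod q) \<noteq> 0"
        using a q by (auto simp: block_def)
      then have "0 < hankel_form q (\<lambda>i. act (s i)) n (block q X)" using R by blast
      moreover have "act ?H (flat q (Suc n) (block q X)) = act ?H X"
        by (rule act_cong) (use e in \<open>simp add: block_hankel_def block_matrix_def\<close>)
      then have "ip ?N (act ?H X) X = ip ?N (act ?H (flat q (Suc n) (block q X))) (flat q (Suc n) (block q X))"
        using e by (auto intro: ip_cong)
      ultimately show "0 < ip ?N (act ?H X) X" unfolding hf by (simp only:)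
    qed
  qed
  then show ?thesis

    by (simp only: pos_hermitian_iff[OF c] herm)
qed

lemma nonneg_hankel_kernel:
  assumes s: "\<forall>i\<le>2 * n. s i \<in> carrier_mat q q"
    and nn: "nonneg_hermitian (block_hankel q s n)"
    and z: "hankel_form q (\<lambda>i. act (s i)) n x = 0" and j: "j \<le> n"
  shows "hankel_apply (\<lambda>i. act (s i)) n x j = 0"
proof -
  have "ip (Suc n * q) (act (block_hankel q s n) (flat q (Suc n) x)) (flat q (Suc n) x) = 0"
    unfolding hankel_form_flat[OF s] by (rule z)
  then have "act (block_hankel q s n) (flat q (Suc n) x) = 0"
    using nonneg_hermitian_kernel[OF block_hankel_carrier nn] by blast
  then have f: "flat q (Suc n) (hankel_apply (\<lambda>i. act (s i)) n x) = 0" 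
    unfolding act_block_hankel[OF s] .
  show ?thesis
  proof (rule ext)
    fix i
    show "hankel_apply (\<lambda>i. act (s i)) n x j i = 0 i"
    proof (cases "i < q")
      case True
      then show ?thesis using fun_cong[OF f, of "j * q + i"] flat_index[of j "Suc n" i q] j by simp
    next
      case False
      then have "act (s (j + k)) (x k) i = 0" if "k \<le> n" for k
        using that s[rule_format, of "j + k"] j False by (intro act_outside) auto
      then show ?thesis by (simp add: hankel_apply_def sum_fun_apply)
    qed
  qed
qed

section \<open>Convolution inverses and Hankel congruences\<close>

lemma sum_triangle: "(\<Sum>a\<le>j. \<Sum>r\<le>a. H a r) = (\<Sum>r\<le>j. \<Sum>l\<le>j - r. H (r + l) r)"
  for H :: "nat \<Rightarrow> nat \<Rightarrow> 'a :: comm_monoid_add"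
proof -
  have "(\<Sum>(a, r)\<in>Sigma {..j} (\<lambda>a. {..a}). H a r) = (\<Sum>(r, l)\<in>Sigma {..j} (\<lambda>r. {..j - r}). H (r + l) r)"
    by (rule sum.reindex_bij_witness[of _ "\<lambda>(r, l). (r + l, r)" "\<lambda>(a, r). (r, a - r)"]) auto
  then show ?thesis by (simp add: sum.Sigma)
qed

lemma sum_swap_upper: "(\<Sum>k\<in>{b..n}. \<Sum>l\<in>{k..n}. H k l) = (\<Sum>l\<in>{b..n}. \<Sum>k\<in>{b..l}. H k l)"
  for H :: "nat \<Rightarrow> nat \<Rightarrow> 'a :: comm_monoid_add"
proof -
  have "(\<Sum>(k, l)\<in>Sigma {b..n} (\<lambda>k. {k..n}). H k l) = (\<Sum>(l, k)\<in>Sigma {b..n} (\<lambda>l. {b..l}). H k l)"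
    by (rule sum.reindex_bij_witness[of _ "\<lambda>(l, k). (k, l)" "\<lambda>(k, l). (l, k)"]) auto
  then show ?thesis by (simp add: sum.Sigma)
qed

lemma sum_swap_corner: "(\<Sum>l\<le>j. \<Sum>i\<le>j - l. H l i) = (\<Sum>i\<le>j. \<Sum>l\<le>j - i. H l i)"
  for H :: "nat \<Rightarrow> nat \<Rightarrow> 'a :: comm_monoid_add"
proof -
  have "(\<Sum>(l, i)\<in>Sigma {..j} (\<lambda>l. {..j - l}). H l i) = (\<Sum>(i, l)\<in>Sigma {..j} (\<lambda>i. {..j - i}). H l i)"
    by (rule sum.reindex_bij_witness[of _ "\<lambda>(l, k). (k, l)" "\<lambda>(k, l). (l, k)"]) auto
  then show ?thesis by (simp add: sum.Sigma)
qed

text \<open>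
  The usual argument $h = h (f g) = (h f) g = g$ for a left inverse $h$ and a right inverse $g$, with convolution as the
  product and a unit $P$ that acts trivially on $g$ and $h$.
\<close>

lemma convolution_inverse_unique:
  fixes f g h :: "nat \<Rightarrow> 'v \<Rightarrow> 'v :: ab_group_add"
  assumes h_add: "\<And>i x y. h i (x + y) = h i x + h i y"
    and right: "\<And>j x. (\<Sum>l\<le>j. f (j - l) (g l x)) = (if j = 0 then P x else 0)"
    and left: "\<And>j x. (\<Sum>l\<le>j. h l (f (j - l) x)) = (if j = 0 then P x else 0)"
    and P_g: "\<And>j x. P (g j x) = g j x" and h_P: "\<And>j x. h j (P x) = h j x"
  shows "h j x = g j x"
proof -
  have h_sum: "h i (\<Sum>k\<in>K. y k) = (\<Sum>k\<in>K. h i (y k))" for i K y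
    by (rule additive.sum[of "h i"]) (unfold_locales, rule h_add)
  have h0: "h i 0 = 0" for i using h_sum[of i undefined "{}"] by simp
  have "(\<Sum>l\<le>j. \<Sum>i\<le>j - l. h l (f (j - l - i) (g i x))) = (\<Sum>l\<le>j. if l = j then h j (P x) else 0)"
    unfolding h_sum[symmetric] right by (intro sum.cong) (auto simp: h0)
  moreover have "(\<Sum>i\<le>j. \<Sum>l\<le>j - i. h l (f (j - i - l) (g i x))) = (\<Sum>i\<le>j. if i = j then P (g j x) else 0)"
    unfolding left by (intro sum.cong) auto
  moreover have "(\<Sum>l\<le>j. \<Sum>i\<le>j - l. h l (f (j - l - i) (g i x))) = (\<Sum>i\<le>j. \<Sum>l\<le>j - i. h l (f (j - i - l) (g i x)))"
    unfolding sum_swap_corner[of "\<lambda>l i. h l (f (j - l - i) (g i x))"]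
    by (intro sum.cong refl) (simp add: add.commute)
  ultimately show ?thesis by (simp add: h_P P_g)
qed

text \<open>
  Multiplication by the upper triangular block Toeplitz matrix with the entries $g_{k-b}$; for self-adjoint $g_i$ it is
  the adjoint of the lower triangular matrix with the entries $g_{j-a}$.
\<close>

definition upper_toeplitz :: "nat \<Rightarrow> (nat \<Rightarrow> 'v \<Rightarrow> 'v :: comm_monoid_add) \<Rightarrow> (nat \<Rightarrow> 'v) \<Rightarrow> nat \<Rightarrow> 'v" where
  "upper_toeplitz n g x b = (\<Sum>k\<in>{b..n}. g (k - b) (x k))"

text \<open>
  Two sequences of additive operators that are inverse to each other under convolution, relative to a
  projection $P$ in place of the identity.
\<close>

locale reciprocal_pair =
  fixes f g :: "nat \<Rightarrow> 'v \<Rightarrow> 'v :: ab_group_add" and P :: "'v \<Rightarrow> 'v"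
  assumes f_add: "f i (x + y) = f i x + f i y"
    and g_add: "g i (x + y) = g i x + g i y"
    and right: "(\<Sum>l\<le>j. f (j - l) (g l x)) = (if j = 0 then P x else 0)"
    and left: "(\<Sum>l\<le>j. g (j - l) (f l x)) = (if j = 0 then P x else 0)"
    and P_g: "P (g j x) = g j x"
    and g_P: "g j (P x) = g j x"
begin

lemma f_sum: "f i (\<Sum>k\<in>K. y k) = (\<Sum>k\<in>K. f i (y k))"
  by (rule additive.sum[of "f i"]) (unfold_locales, rule f_add)

lemma g_sum: "g i (\<Sum>k\<in>K. y k) = (\<Sum>k\<in>K. g i (y k))"
  by (rule additive.sum[of "g i"]) (unfold_locales, rule g_add)

lemma g_zero: "g i 0 = 0"
  using g_sum[of i undefined "{}"] by simp

lemma g_uminus: "g i (- x) = - g i x"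
  by (rule additive.minus[of "g i"]) (unfold_locales, rule g_add)

lemma left': "(\<Sum>l\<le>j. g l (f (j - l) x)) = (if j = 0 then P x else 0)"
proof -
  have "(\<Sum>l\<le>j. g l (f (j - l) x)) = (\<Sum>l\<le>j. g (j - l) (f l x))"
    by (rule sum.reindex_bij_witness[of _ "\<lambda>l. j - l" "\<lambda>l. j - l"]) auto
  then show ?thesis using left by simp
qed

lemma right': "(\<Sum>l\<le>j. f l (g (j - l) x)) = (if j = 0 then P x else 0)"
proof -
  have "(\<Sum>l\<le>j. f l (g (j - l) x)) = (\<Sum>l\<le>j. f (j - l) (g l x))"
    by (rule sum.reindex_bij_witness[of _ "\<lambda>l. j - l" "\<lambda>l. j - l"]) auto
  then show ?thesis using right by simp
qed

text \<open>
  The sum over $b$ is a part of the vanishing coefficient $a + k + 1$ of $f g$; the rest of that coefficient is on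
  the right.
\<close>

lemma shifted_row: "(\<Sum>b\<le>k. f (a + b + 1) (g (k - b) x)) = - (\<Sum>r\<le>a. f (a - r) (g (r + k + 1) x))"
proof -
  have "(\<Sum>l\<le>a + k + 1. f (a + k + 1 - l) (g l x)) = 0" using right[of "a + k + 1"] by simp
  moreover have "{..a + k + 1} = {..k} \<union> {k + 1..a + k + 1}" by auto
  then have "(\<Sum>l\<le>a + k + 1. f (a + k + 1 - l) (g l x))
      = (\<Sum>l\<le>k. f (a + k + 1 - l) (g l x)) + (\<Sum>l\<in>{k + 1..a + k + 1}. f (a + k + 1 - l) (g l x))"
    by (simp only:) (rule sum.union_disjoint, auto)
  moreover have "(\<Sum>l\<le>k. f (a + k + 1 - l) (g l x)) = (\<Sum>b\<le>k. f (a + b + 1) (g (k - b) x))"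
    by (rule sum.reindex_bij_witness[of _ "\<lambda>l. k - l" "\<lambda>l. k - l"]) (auto simp: Suc_diff_le)
  moreover have "(\<Sum>l\<in>{k + 1..a + k + 1}. f (a + k + 1 - l) (g l x)) = (\<Sum>r\<le>a. f (a - r) (g (r + k + 1) x))"
    by (rule sum.reindex_bij_witness[of _ "\<lambda>r. r + k + 1" "\<lambda>l. l - k - 1"]) auto
  ultimately show ?thesis by (simp add: eq_neg_iff_add_eq_0)
qed

text \<open>
  The coefficient form of $g(x) (f(x) - f(y)) g(y) = g(y) - g(x)$, divided by $x - y$.
\<close>

lemma shifted_congruence:
  "(\<Sum>a\<le>j. g (j - a) (\<Sum>b\<le>k. f (a + b + 1) (g (k - b) x))) = - g (j + k + 1) x"
proof -
  have "(\<Sum>a\<le>j. g (j - a) (\<Sum>b\<le>k. f (a + b + 1) (g (k - b) x)))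
      = - (\<Sum>a\<le>j. \<Sum>r\<le>a. g (j - a) (f (a - r) (g (r + k + 1) x)))"
    unfolding shifted_row g_uminus g_sum sum_negf ..
  also have "(\<Sum>a\<le>j. \<Sum>r\<le>a. g (j - a) (f (a - r) (g (r + k + 1) x)))
      = (\<Sum>r\<le>j. \<Sum>l\<le>j - r. g (j - r - l) (f l (g (r + k + 1) x)))"
    unfolding sum_triangle by simp
  also have "\<dots> = (\<Sum>r\<le>j. if j = r then P (g (j + k + 1) x) else 0)"
    unfolding left by (intro sum.cong) auto
  also have "\<dots> = g (j + k + 1) x" by (simp add: P_g)
  finally show ?thesis .
qed

text \<open>
  The coefficient form of $g(x) (x f(x) - y f(y)) g(y) = x g(y) - y g(x)$, divided by $x - y$, for
  rows after the first one. It follows from the shifted identity since the summand for $a = 0$ is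
  again a coefficient of $f g$.
\<close>

lemma unshifted_congruence:
  "(\<Sum>a\<le>Suc j. g (Suc j - a) (\<Sum>b\<le>k. f (a + b) (g (k - b) x))) = (if k = 0 then 0 else - g (Suc j + k) x)"
proof -
  have "(\<Sum>a\<le>Suc j. g (Suc j - a) (\<Sum>b\<le>k. f (a + b) (g (k - b) x)))
    = g (Suc j) (\<Sum>b\<le>k. f b (g (k - b) x)) + (\<Sum>a\<le>j. g (j - a) (\<Sum>b\<le>k. f (a + b + 1) (g (k - b) x)))"
    unfolding sum.atMost_Suc_shift[of _ j] by simp
  also have "\<dots> = g (Suc j) (if k = 0 then P x else 0) - g (Suc j + k) x"
    unfolding right' shifted_congruence by simp
  finally show ?thesis by (simp add: g_P g_zero)
qed

lemma hankel_apply_upper_toeplitz: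
  "hankel_apply (\<lambda>i. f (i + c)) n (upper_toeplitz n g x) a = (\<Sum>k\<le>n. \<Sum>b\<le>k. f (a + b + c) (g (k - b) (x k)))"
  unfolding hankel_apply_def upper_toeplitz_def f_sum atMost_atLeast0
  by (rule sum_swap_upper)

lemma hankel_apply_shifted:
  "hankel_apply (\<lambda>i. - g (i + 1) ) n x j = (\<Sum>a\<le>j. g (j - a) (hankel_apply (\<lambda>i. f (i + 1)) n (upper_toeplitz n g x) a))"
proof -
  have "(\<Sum>a\<le>j. g (j - a) (hankel_apply (\<lambda>i. f (i + 1)) n (upper_toeplitz n g x) a))
    = (\<Sum>a\<le>j. \<Sum>k\<le>n. g (j - a) (\<Sum>b\<le>k. f (a + b + 1) (g (k - b) (x k))))"
    unfolding hankel_apply_upper_toeplitz[of 1] g_sum ..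
  also have "\<dots> = (\<Sum>k\<le>n. \<Sum>a\<le>j. g (j - a) (\<Sum>b\<le>k. f (a + b + 1) (g (k - b) (x k))))"
    by (rule sum.swap)
  also have "\<dots> = hankel_apply (\<lambda>i. - g (i + 1)) n x j"
    unfolding shifted_congruence hankel_apply_def by simp
  finally show ?thesis ..
qed

text \<open>
  The rows after the first one of the congruence that splits off the block $g_0$: their first block is zero, and the
  others form the Hankel matrix of $-g_{i+2}$.
\<close>

lemma hankel_apply_unshifted:
  "hankel_apply (\<lambda>i. - g (i + 2)) n (\<lambda>k. x (Suc k)) j
    = (\<Sum>a\<le>Suc j. g (Suc j - a) (hankel_apply f (Suc n) (upper_toeplitz (Suc n) g x) a))"
proof -
  have "(\<Sum>a\<le>Suc j. g (Suc j - a) (hankel_apply f (Suc n) (upper_toeplitz (Suc n) g x) a))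
    = (\<Sum>a\<le>Suc j. \<Sum>k\<le>Suc n. g (Suc j - a) (\<Sum>b\<le>k. f (a + b) (g (k - b) (x k))))"
  proof -
    have "hankel_apply f (Suc n) (upper_toeplitz (Suc n) g x) a = (\<Sum>k\<le>Suc n. \<Sum>b\<le>k. f (a + b) (g (k - b) (x k)))" for a
      using hankel_apply_upper_toeplitz[of 0 "Suc n" x a] by (simp only: add_0_right)
    then show ?thesis by (simp only: g_sum)
  qed
  also have "\<dots> = (\<Sum>k\<le>Suc n. \<Sum>a\<le>Suc j. g (Suc j - a) (\<Sum>b\<le>k. f (a + b) (g (k - b) (x k))))"
    by (rule sum.swap)
  also have "\<dots> = (\<Sum>k\<le>n. - g (Suc j + Suc k) (x (Suc k)))"
    unfolding unshifted_congruence sum.atMost_Suc_shift[of _ n] by simp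
  finally show ?thesis by (simp add: hankel_apply_def)
qed

lemma upper_toeplitz_inverse:
  assumes "b \<le> n"
  shows "upper_toeplitz n g (upper_toeplitz n f z) b = P (z b)"
proof -
  have "upper_toeplitz n g (upper_toeplitz n f z) b = (\<Sum>l\<in>{b..n}. \<Sum>k\<in>{b..l}. g (k - b) (f (l - k) (z l)))"
    unfolding upper_toeplitz_def g_sum by (rule sum_swap_upper)
  also have "\<dots> = (\<Sum>l\<in>{b..n}. if l = b then P (z b) else 0)"
  proof (rule sum.cong)
    fix l assume l: "l \<in> {b..n}"
    have "(\<Sum>k\<in>{b..l}. g (k - b) (f (l - k) (z l))) = (\<Sum>i\<le>l - b. g i (f (l - b - i) (z l)))"
      using l by (intro sum.reindex_bij_witness[of _ "\<lambda>i. i + b" "\<lambda>k. k - b"]) auto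
    then show "(\<Sum>k\<in>{b..l}. g (k - b) (f (l - k) (z l))) = (if l = b then P (z b) else 0)"
      unfolding left' using l by auto
  qed simp
  finally show ?thesis using assms by simp
qed

lemma upper_toeplitz_inverse_swapped:
  assumes "b \<le> n"
  shows "upper_toeplitz n f (upper_toeplitz n g z) b = P (z b)"
proof -
  have "upper_toeplitz n f (upper_toeplitz n g z) b = (\<Sum>l\<in>{b..n}. \<Sum>k\<in>{b..l}. f (k - b) (g (l - k) (z l)))"
    unfolding upper_toeplitz_def f_sum by (rule sum_swap_upper)
  also have "\<dots> = (\<Sum>l\<in>{b..n}. if l = b then P (z b) else 0)"
  proof (rule sum.cong)
    fix l assume l: "l \<in> {b..n}"
    have "(\<Sum>k\<in>{b..l}. f (k - b) (g (l - k) (z l))) = (\<Sum>i\<le>l - b. f i (g (l - b - i) (z l)))"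
      using l by (intro sum.reindex_bij_witness[of _ "\<lambda>i. i + b" "\<lambda>k. k - b"]) auto
    then show "(\<Sum>k\<in>{b..l}. f (k - b) (g (l - k) (z l))) = (if l = b then P (z b) else 0)"
      unfolding right' using l by auto
  qed simp
  finally show ?thesis using assms by simp
qed

end

section \<open>Kernels of nonnegative block Hankel matrices\<close>

text \<open>
  For a nonnegative Hermitian Hankel matrix this is the vanishing of its last Schur complement, in a form that
  can be carried along a congruence.
\<close>

definition full_kernel :: "(nat \<Rightarrow> 'v \<Rightarrow> 'v :: comm_monoid_add) \<Rightarrow> nat \<Rightarrow> bool" where
  "full_kernel F n \<longleftrightarrow> (\<forall>\<xi>. \<exists>z. z n = \<xi> \<and> (\<forall>j\<le>n. hankel_apply F n z j = 0))"

lemma hankel_apply_outside: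
  assumes "\<forall>i\<le>N. s i \<in> carrier_mat q q" "j + n \<le> N" "q \<le> i"
  shows "hankel_apply (\<lambda>i. act (s i)) n x j i = 0"
proof -
  have "act (s (j + k)) (x k) i = 0" if "k \<le> n" for k
    using assms(1)[rule_format, of "j + k"] that assms(2,3) by (intro act_outside) auto
  then show ?thesis by (simp add: hankel_apply_def sum_fun_apply)
qed

lemma flat_cong: "(\<And>j i. j < m \<Longrightarrow> i < q \<Longrightarrow> x j i = y j i) \<Longrightarrow> flat q m x = flat q m y"
  by (rule ext) (metis flat_def less_mult_imp_div_less mod_less_divisor mult_0_right neq0_conv not_less_zero)

text \<open>
  Induction on $i$. Let $2k < i$ with $i - k \le n$. If $s_{2k} x = 0$, then the form of $H_n$
  vanishes at the vector with $x$ in block $k$ and zeros elsewhere. This vector lies in the kernel, and block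
  $i - k$ of its image is $s_i x$.
\<close>

lemma hankel_dominance:
  assumes s: "\<forall>i\<le>2 * n. s i \<in> carrier_mat q q"
    and nn: "nonneg_hermitian (block_hankel q s n)"
    and x: "act (s 0) x = 0"
  shows "i < 2 * n \<Longrightarrow> act (s i) x = 0"
proof (induction i rule: less_induct)
  case (less i)
  show ?case
  proof (cases "i = 0")
    case True
    then show ?thesis using x by simp
  next
    case False
    \<comment> \<open>the largest \<open>k\<close> with \<open>2 * k < i\<close>; the bound \<open>i < 2 * n\<close> then gives \<open>i - k \<le> n\<close>\<close>
    define k where "k = (i - 1) div 2"
    have k: "2 * k < i" "k \<le> i" "i - k \<le> n" "k \<le> n" using less.prems False by (auto simp: k_def)
    have z: "act (s (2 * k)) x = 0" using less.IH[of "2 * k"] k less.prems by linarith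
    define y where "y = (\<lambda>j. if j = k then x else 0)"
    have ap: "hankel_apply (\<lambda>i. act (s i)) n y j = act (s (j + k)) x" for j
    proof -
      have "hankel_apply (\<lambda>i. act (s i)) n y j = (\<Sum>l\<le>n. if l = k then act (s (j + k)) x else 0)"
        unfolding hankel_apply_def y_def by (intro sum.cong) auto
      then show ?thesis using k by simp
    qed
    have "hankel_form q (\<lambda>i. act (s i)) n y = (\<Sum>j\<le>n. if j = k then ip q (act (s (k + k)) x) x else 0)"
      unfolding hankel_form_def ap by (intro sum.cong) (auto simp: y_def)
    then have "hankel_form q (\<lambda>i. act (s i)) n y = 0" using z k by (simp add: mult_2)
    from nonneg_hankel_kernel[OF s nn this, of "i - k"] show ?thesis unfolding ap using k by simp
  qed
qed

text \<open>
  Write $H_n$ with the leading block $H = H_{n-1}$, the last block column $C$, the last block row $R = C^*$ and the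
  corner $D$, so that $L = D - R G C$ with $G = H^\dagger$. Nonnegativity of $H_n$ makes $R$ vanish on the kernel of $H$, so
  $R G H = R$ and $H G C = C$. Hence the vector with the blocks $-G C \xi$ and $\xi$ is mapped to $(0, L \xi)$;
  conversely, if the vector with the blocks $z$ and $\xi$ is in the kernel, then
  $L \xi = D \xi + R G H z = D \xi + R z = 0$.
\<close>

lemma hankel_schur_eq_0_iff:
  assumes s: "\<forall>i\<le>2 * n. s i \<in> carrier_mat q q"
    and nn: "nonneg_hermitian (block_hankel q s n)"
  shows "hankel_schur q s n = 0\<^sub>m q q \<longleftrightarrow> full_kernel (\<lambda>i. act (s i)) n"
proof (cases n)
  case 0
  have s0: "s 0 \<in> carrier_mat q q" using s by simp
  have "s 0 = 0\<^sub>m q q \<longleftrightarrow> (\<forall>\<xi>. act (s 0) \<xi> = 0)"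
  proof
    assume "\<forall>\<xi>. act (s 0) \<xi> = 0"
    then show "s 0 = 0\<^sub>m q q" by (intro mat_eqI_act[OF s0]) simp_all
  qed simp
  moreover have "full_kernel (\<lambda>i. act (s i)) 0 \<longleftrightarrow> (\<forall>\<xi>. act (s 0) \<xi> = 0)"
  proof
    assume full: "full_kernel (\<lambda>i. act (s i)) 0"
    show "\<forall>\<xi>. act (s 0) \<xi> = 0"
    proof
      fix \<xi>
      obtain z where "z 0 = \<xi>" "hankel_apply (\<lambda>i. act (s i)) 0 z 0 = 0"
        using full unfolding full_kernel_def by blast
      then show "act (s 0) \<xi> = 0" by (simp add: hankel_apply_def)
    qed
  next
    assume "\<forall>\<xi>. act (s 0) \<xi> = 0"
    then show "full_kernel (\<lambda>i. act (s i)) 0"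
      unfolding full_kernel_def hankel_apply_def by (intro allI, rule_tac x="\<lambda>_. \<xi>" in exI) simp
  qed
  ultimately show ?thesis using 0 by (simp add: hankel_schur_def)
next
  case (Suc m)
  define H where "H = block_hankel q s m"
  define G where "G = pinv H"
  define R where "R = block_matrix q 1 n (\<lambda>_ k. s (n + k))"
  define C where "C = block_matrix q n 1 (\<lambda>j _. s (n + j))"
  define D where "D = s (2 * n)"
  have sm: "\<forall>i\<le>2 * m. s i \<in> carrier_mat q q" using s Suc by simp
  have herm: "\<forall>i\<le>2 * n. mat_adjoint (s i) = s i" using nn nonneg_block_hankel_iff[OF s] by blast
  have H: "H \<in> carrier_mat (n * q) (n * q)" unfolding H_def Suc by (rule block_hankel_carrier)
  have hH: "mat_adjoint H = H" unfolding H_def block_hankel_hermitian_iff[OF sm] using herm Suc by simp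
  note G = pinv_hermitian[OF H hH, folded G_def]
  have R: "R \<in> carrier_mat q (n * q)" and C: "C \<in> carrier_mat (n * q) q" and D: "D \<in> carrier_mat q q"
    using s by (auto simp: R_def C_def D_def block_matrix_def)
  have dims: "dim_row H = n * q" "dim_col H = n * q" "dim_row G = n * q" "dim_col G = n * q"
    "dim_row R = q" "dim_col R = n * q" "dim_row C = n * q" "dim_col C = q" "dim_row D = q" "dim_col D = q"
    using H G(1) R C D by auto
  define L where "L = D - R * G * C"
  have L: "L \<in> carrier_mat q q" using R C D dims by (auto simp: L_def)
  have schur: "hankel_schur q s n = L"
    using Suc by (simp add: hankel_schur_def L_def R_def C_def D_def G_def H_def)
  have actL: "act L \<xi> = act D \<xi> - act R (act G (act C \<xi>))" for \<xi>
    by (simp add: L_def act_minus_mat act_mult dims)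
  have actH: "act H (flat q n z) = flat q n (hankel_apply (\<lambda>i. act (s i)) m z)" for z
    unfolding H_def Suc by (rule act_block_hankel[OF sm])
  have actC: "act C \<xi> = flat q n (\<lambda>j. act (s (n + j)) \<xi>)" for \<xi>
  proof -
    have "act C \<xi> = act C (flat q 1 (\<lambda>_. \<xi>))" by (rule act_cong) (simp add: flat_def dims)
    also have "\<dots> = flat q n (\<lambda>j. \<Sum>k<(1::nat). act (s (n + j)) \<xi>)"
      unfolding C_def by (rule act_block_matrix[of n 1 "\<lambda>j _. s (n + j)"]) (use s Suc in auto)
    also have "(\<lambda>j. \<Sum>k<(1::nat). act (s (n + j)) \<xi>) = (\<lambda>j. act (s (n + j)) \<xi>)"
      unfolding One_nat_def lessThan_Suc lessThan_0 by simp
    finally show ?thesis .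
  qed
  have actR: "act R (flat q n z) = (\<Sum>k<n. act (s (n + k)) (z k))" for z
  proof -
    have "act R (flat q n z) = flat q 1 (\<lambda>_. \<Sum>k<n. act (s (n + k)) (z k))"
      unfolding R_def by (rule act_block_matrix) (use s Suc in auto)
    moreover have "act (s (n + k)) (z k) i = 0" if "k < n" "q \<le> i" for k i
      using s[rule_format, of "n + k"] that by (intro act_outside) auto
    ultimately show ?thesis by (auto simp: flat_def fun_eq_iff sum_fun_apply)
  qed
  have as_flat: "act M w = act M (flat q n (block q w))" if "dim_col M = n * q" for M w
    by (rule act_cong) (use that flat_block in simp)
  \<comment> \<open>append a zero block to a kernel vector of the leading block: the form of the full matrix vanishes there\<close>
  have ker: "act R w = 0" if w: "act H w = 0" for w
  proof -
    define x where "x = (\<lambda>j. if j < n then block q w j else 0)"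
    have fx: "flat q n (block q w) = flat q n x" by (rule flat_cong) (simp add: x_def)
    have ap: "hankel_apply (\<lambda>i. act (s i)) n x j = hankel_apply (\<lambda>i. act (s i)) m x j" for j
      unfolding hankel_apply_def Suc by (simp add: x_def Suc)
    have "act H (flat q n x) = 0" using w as_flat[of H w] fx dims by simp
    then have z: "flat q n (hankel_apply (\<lambda>i. act (s i)) m x) = 0" unfolding actH .
    have "ip q (hankel_apply (\<lambda>i. act (s i)) n x j) (x j) = 0" if "j \<le> n" for j
    proof (cases "j < n")
      case True
      have "hankel_apply (\<lambda>i. act (s i)) m x j i = 0" if "i < q" for i
        using fun_cong[OF z, of "j * q + i"] flat_index[OF True that, of "hankel_apply (\<lambda>i. act (s i)) m x"] by simp
      then show ?thesis unfolding ap by (simp add: ip_def)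
    qed (simp add: x_def)
    then have "hankel_form q (\<lambda>i. act (s i)) n x = 0" by (simp add: hankel_form_def)
    from nonneg_hankel_kernel[OF s nn this, of n] have "hankel_apply (\<lambda>i. act (s i)) m x n = 0"
      unfolding ap by simp
    then have "(\<Sum>k<n. act (s (n + k)) (x k)) = 0" by (simp add: hankel_apply_def Suc lessThan_Suc_atMost)
    then show ?thesis using actR[of x] as_flat[of R w] fx dims by simp
  qed
  have HGH: "act H (act G (act H w)) = act H w" and GH: "act G (act H w) = act H (act G w)" for w
    using arg_cong[OF G(2), of "\<lambda>M. act M w"] arg_cong[OF G(4), of "\<lambda>M. act M w"]
    by (simp_all add: act_mult dims)
  have RGH: "act R (act G (act H w)) = act R w" for w
  proof -
    have "act H (w - act G (act H w)) = 0" by (simp add: act_diff HGH)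
    from ker[OF this] show ?thesis by (simp add: act_diff)
  qed
  have adjC: "mat_adjoint C = R"
  proof (rule eq_matI)
    fix i a assume "i < dim_row R" "a < dim_col R"
    then have ia: "i < q" "a < n * q" by (simp_all add: dims)
    then have q: "0 < q" by simp
    have d: "a div q < n" "a mod q < q" using ia q by (auto simp: less_mult_imp_div_less)
    have "mat_adjoint (s (n + a div q)) $$ (i, a mod q) = cnj (s (n + a div q) $$ (a mod q, i))"
      using s[rule_format, of "n + a div q"] d ia by (intro adjoint_index) auto
    then have e: "s (n + a div q) $$ (i, a mod q) = cnj (s (n + a div q) $$ (a mod q, i))"
      using herm d by simp
    have "mat_adjoint C $$ (i, a) = cnj (C $$ (a, i))"
      by (rule adjoint_index) (use ia dims in simp_all)
    also have "\<dots> = R $$ (i, a)" using ia e by (simp add: C_def R_def block_matrix_def)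
    finally show "mat_adjoint C $$ (i, a) = R $$ (i, a)" .
  qed (simp_all add: dims)
  have HGC: "act H (act G (act C \<xi>)) = act C \<xi>" for \<xi>
  proof -
    define y where "y = act C \<xi> - act H (act G (act C \<xi>))"
    have HG: "ip (n * q) (act H (act G v)) u = ip (n * q) v (act H (act G u))" for u v
      using ip_hermitian[of "H * G" "n * q" v u] G(1,5) H by (simp add: act_mult dims)
    have "ip (n * q) y y = ip (n * q) (act C \<xi>) y - ip (n * q) (act H (act G (act C \<xi>))) y"
      using ip_diff_left[of "n * q" "act C \<xi>" "act H (act G (act C \<xi>))" y] unfolding y_def[symmetric] .
    also have "\<dots> = ip (n * q) (act C \<xi>) (y - act H (act G y))"
      unfolding HG ip_diff_right ..
    also have "\<dots> = ip q \<xi> (act R (y - act H (act G y)))"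
      by (simp only: ip_adjoint[OF C] adjC)
    also have "act R (y - act H (act G y)) = 0"
    proof (rule ker)
      have "act H (act H (act G y)) = act H y" unfolding GH[of y, symmetric] by (rule HGH)
      then show "act H (y - act H (act G y)) = 0" by (simp add: act_diff)
    qed
    finally have "ip (n * q) y y = 0" by (simp only: ip_zero)
    then have "y a = 0" for a
      using ip_self_eq_0[of "n * q" y a] act_outside[of C a] act_outside[of H a]
      by (cases "a < n * q") (auto simp: y_def dims)
    then have "y = 0" by (simp add: fun_eq_iff)
    then show ?thesis by (simp add: y_def)
  qed
  have split: "hankel_apply (\<lambda>i. act (s i)) n z j = hankel_apply (\<lambda>i. act (s i)) m z j + act (s (j + n)) (z n)" for z j
    by (simp add: hankel_apply_def Suc)
  have "L = 0\<^sub>m q q \<longleftrightarrow> full_kernel (\<lambda>i. act (s i)) n"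
  proof
    assume L0: "L = 0\<^sub>m q q"
    show "full_kernel (\<lambda>i. act (s i)) n" unfolding full_kernel_def
    proof
      fix \<xi>
      define w where "w = act G (act C \<xi>)"
      define z where "z = (\<lambda>k. if k < n then - block q w k else \<xi>)"
      have fz: "flat q n (block q w) = - flat q n z" by (simp add: z_def flat_def fun_eq_iff less_mult_imp_div_less)
      have Hz: "act H (flat q n z) = - act C \<xi>"
        using HGC[of \<xi>] as_flat[OF dims(2), of w] unfolding w_def[symmetric] fz act_uminus
        by (metis minus_minus)
      have Rz: "act R (flat q n z) = - act R w"
        using as_flat[of R w] by (simp add: dims fz act_uminus)
      have "hankel_apply (\<lambda>i. act (s i)) n z j = 0" if j: "j \<le> n" for j
      proof (cases "j < n")
        case True
        show ?thesis
        proof (rule ext)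
          fix i
          show "hankel_apply (\<lambda>i. act (s i)) n z j i = 0 i"
          proof (cases "i < q")
            case i: True
            have "flat q n (hankel_apply (\<lambda>i. act (s i)) m z) = - flat q n (\<lambda>j. act (s (n + j)) \<xi>)"
              using Hz unfolding actH actC .
            from fun_cong[OF this, of "j * q + i"]
            have "hankel_apply (\<lambda>i. act (s i)) m z j i = - act (s (n + j)) \<xi> i"
              by (simp add: flat_index[OF True i])
            then show ?thesis unfolding split by (simp add: z_def add.commute)
          next
            case False
            then show ?thesis using hankel_apply_outside[OF s, of j n i z] j by simp
          qed
        qed
      next
        case False
        then have jn: "j = n" using j by simp
        have "hankel_apply (\<lambda>i. act (s i)) m z n = act R (flat q n z)"
          unfolding actR by (simp add: hankel_apply_def Suc lessThan_Suc_atMost)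
        then have "hankel_apply (\<lambda>i. act (s i)) n z n = - act R w + act D \<xi>"
          unfolding split Rz by (simp add: z_def D_def mult_2)
        also have "\<dots> = act L \<xi>" by (simp add: actL w_def)
        finally show ?thesis using L0 jn by simp
      qed
      then show "\<exists>z. z n = \<xi> \<and> (\<forall>j\<le>n. hankel_apply (\<lambda>i. act (s i)) n z j = 0)"
        by (intro exI[of _ z]) (simp add: z_def)
    qed
  next
    assume full: "full_kernel (\<lambda>i. act (s i)) n"
    show "L = 0\<^sub>m q q"
    proof (rule mat_eqI_act[OF L])
      fix \<xi>
      obtain z where z: "z n = \<xi>" "\<And>j. j \<le> n \<Longrightarrow> hankel_apply (\<lambda>i. act (s i)) n z j = 0"
        using full unfolding full_kernel_def by blast
      have r: "hankel_apply (\<lambda>i. act (s i)) m z j = - act (s (n + j)) \<xi>" if "j \<le> n" for j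
        using z(2)[OF that] unfolding split z(1) by (simp add: add.commute eq_neg_iff_add_eq_0)
      have "act H (flat q n z) = - act C \<xi>"
      proof -
        have "flat q n (hankel_apply (\<lambda>i. act (s i)) m z) = flat q n (\<lambda>j. - act (s (n + j)) \<xi>)"
          by (rule flat_cong) (simp add: r)
        then show ?thesis unfolding actH actC by (simp add: flat_def fun_eq_iff)
      qed
      then have C: "act C \<xi> = - act H (flat q n z)" by simp
      have "act R (flat q n z) = hankel_apply (\<lambda>i. act (s i)) m z n"
        unfolding actR by (simp add: hankel_apply_def Suc lessThan_Suc_atMost)
      then have Rz: "act R (flat q n z) = - act D \<xi>" using r[of n] by (simp add: D_def mult_2)
      show "act L \<xi> = act (0\<^sub>m q q) \<xi>"
        unfolding actL C act_uminus RGH Rz by simp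
    qed simp
  qed
  then show ?thesis using schur by simp
qed

section \<open>Hermitian sequences and their inverses relative to a projection\<close>

text \<open>
  The situation of both congruences: $V$ is a right convolution inverse of the compressed sequence $E c_i E$ relative
  to the projection $E$, and everything but $V$ is Hermitian by assumption. It will be used
  for $c = u$ and for $c = s$.
\<close>

locale hermitian_reciprocal =
  fixes q :: nat and E :: "complex mat" and c V :: "nat \<Rightarrow> complex mat"
  assumes E: "E \<in> carrier_mat q q" and E_herm: "mat_adjoint E = E" and EE: "E * E = E"
    and c: "c i \<in> carrier_mat q q" and c_herm: "mat_adjoint (c i) = c i"
    and V: "V i \<in> carrier_mat q q" and EV: "E * V i = V i" and VE: "V i * E = V i"
    and conv: "(\<Sum>l\<le>j. act E (act (c (j - l)) (act E (act (V l) x)))) = (if j = 0 then act E x else 0)"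
begin

definition f :: "nat \<Rightarrow> (nat \<Rightarrow> complex) \<Rightarrow> nat \<Rightarrow> complex" where
  "f i x = act E (act (c i) (act E x))"

definition g :: "nat \<Rightarrow> (nat \<Rightarrow> complex) \<Rightarrow> nat \<Rightarrow> complex" where
  "g i = act (V i)"

lemma dims: "dim_row E = q" "dim_col E = q" "dim_row (c i) = q" "dim_col (c i) = q"
  "dim_row (V i) = q" "dim_col (V i) = q"
  using E c[of i] V[of i] by auto

lemma act_EE: "act E (act E x) = act E x"
  using act_mult[of E E x] by (simp add: dims EE)

lemma act_EV: "act E (act (V i) x) = act (V i) x"
  using act_mult[of E "V i" x] by (simp add: dims EV)

lemma act_VE: "act (V i) (act E x) = act (V i) x"
  using act_mult[of "V i" E x] by (simp add: dims VE)

lemma ip_E: "ip q (act E x) y = ip q x (act E y)"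
  by (rule ip_hermitian[OF E E_herm])

lemma ip_f: "ip q (f i x) y = ip q x (f i y)"
  by (simp add: f_def ip_E ip_hermitian[OF c c_herm])

text \<open>
  The adjoints of the $V_i$ form a left inverse because the $c_i$ are Hermitian, and left and right inverses agree.
\<close>

lemma V_herm: "mat_adjoint (V i) = V i"
proof -
  define h where "h i = act (mat_adjoint (V i))" for i
  have adj: "ip q (act (V i) x) y = ip q x (h i y)" for i x y
    unfolding h_def by (rule ip_adjoint[OF V])
  have h_out: "q \<le> a \<Longrightarrow> h i x a = 0" for i x a
    by (simp add: h_def act_outside dims)
  have left: "(\<Sum>l\<le>j. h l (f (j - l) y)) = (if j = 0 then act E y else 0)" for j y
  proof -
    define w where "w = (\<Sum>l\<le>j. h l (f (j - l) y)) - (if j = 0 then act E y else 0)"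
    have "ip q x w = 0" for x
    proof -
      have "ip q x (\<Sum>l\<le>j. h l (f (j - l) y)) = ip q (\<Sum>l\<le>j. f (j - l) (act (V l) x)) y"
        unfolding ip_sum_right ip_sum_left ip_f adj ..
      also have "\<dots> = ip q (if j = 0 then act E x else 0) y"
        unfolding f_def conv ..
      also have "\<dots> = ip q x (if j = 0 then act E y else 0)" by (simp add: ip_E)
      finally show ?thesis by (simp add: w_def ip_diff_right)
    qed
    then have "w a = 0" if "a < q" for a using ip_self_eq_0[of q w a] that by blast
    moreover have "w a = 0" if "q \<le> a" for a
      using that by (simp add: w_def sum_fun_apply h_out act_outside dims)
    ultimately have "w = 0" by (metis ext linorder_not_le zero_fun_apply)
    then show ?thesis by (simp add: w_def)
  qed
  have "h i x = act (V i) x" for x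
  proof (rule convolution_inverse_unique[of h f "\<lambda>i. act (V i)" "act E"])
    show "h i (x + y) = h i x + h i y" for i x y by (simp add: h_def act_add)
    show "(\<Sum>l\<le>j. f (j - l) (act (V l) x)) = (if j = 0 then act E x else 0)" for j x
      unfolding f_def by (rule conv)
    show "h j (act E x) = h j x" for j x
    proof -
      have "mat_adjoint (E * V j) = mat_adjoint (V j) * E" by (simp add: adjoint_mult dims E_herm)
      then show ?thesis unfolding h_def using act_mult[of "mat_adjoint (V j)" E x] by (simp add: EV dims)
    qed
  qed (simp_all only: left act_EV)
  then show ?thesis
    by (intro mat_eqI_act[of _ q q]) (auto simp: h_def dims mem_carrier_mat_iff V)
qed

lemma ip_g: "ip q (g i x) y = ip q x (g i y)"
  unfolding g_def by (rule ip_hermitian[OF V V_herm])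

sublocale reciprocal_pair f g "act E"
proof
  show right: "(\<Sum>l\<le>j. f (j - l) (g l x)) = (if j = 0 then act E x else 0)" for j x
    unfolding f_def g_def by (rule conv)
  show "(\<Sum>l\<le>j. g (j - l) (f l x)) = (if j = 0 then act E x else 0)" for j x
  proof -
    define w where "w = (\<Sum>l\<le>j. g (j - l) (f l x)) - (if j = 0 then act E x else 0)"
    have "ip q w y = 0" for y
    proof -
      have "ip q (\<Sum>l\<le>j. g (j - l) (f l x)) y = ip q x (\<Sum>l\<le>j. f l (g (j - l) y))"
        unfolding ip_sum_right ip_sum_left ip_f ip_g ..
      also have "(\<Sum>l\<le>j. f l (g (j - l) y)) = (\<Sum>l\<le>j. f (j - l) (g l y))"
        by (rule sum.reindex_bij_witness[of _ "\<lambda>l. j - l" "\<lambda>l. j - l"]) auto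
      also have "ip q x \<dots> = ip q (if j = 0 then act E x else 0) y"
        unfolding right by (simp add: ip_E)
      finally show ?thesis by (simp add: w_def ip_diff_left)
    qed
    then have "w a = 0" if "a < q" for a using ip_self_eq_0[of q w a] that by blast
    moreover have "w a = 0" if "q \<le> a" for a
      using that by (simp add: w_def sum_fun_apply g_def act_outside dims)
    ultimately have "w = 0" by (metis ext linorder_not_le zero_fun_apply)
    then show ?thesis by (simp add: w_def)
  qed
qed (simp_all add: f_def g_def act_add act_EV act_VE)

lemma E_upper_toeplitz: "act E (upper_toeplitz n g x b) = upper_toeplitz n g x b"
  unfolding upper_toeplitz_def act_sum by (simp add: g_def act_EV)

text \<open>
  Moving a lower triangular Toeplitz matrix to the other side of the inner product.
\<close>

lemma form_lift:
  assumes "\<And>j. j \<le> n \<Longrightarrow> t j = (\<Sum>a\<le>j. g (j - a) (h a))"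
  shows "(\<Sum>j\<le>n. ip q (t j) (x j)) = (\<Sum>a\<le>n. ip q (h a) (upper_toeplitz n g x a))"
proof -
  have "(\<Sum>j\<le>n. ip q (t j) (x j)) = (\<Sum>j\<in>{0..n}. \<Sum>a\<in>{0..j}. ip q (h a) (g (j - a) (x j)))"
    unfolding atMost_atLeast0[symmetric] using assms by (intro sum.cong) (simp_all add: ip_sum_left ip_g)
  also have "\<dots> = (\<Sum>a\<in>{0..n}. \<Sum>j\<in>{a..n}. ip q (h a) (g (j - a) (x j)))"
    by (rule sum_swap_upper[symmetric])
  finally show ?thesis by (simp add: upper_toeplitz_def ip_sum_right atMost_atLeast0)
qed

text \<open>
  The vectors produced by the Toeplitz matrix of $V$ have all blocks in the range of $E$, and there
  the compression of $c$ is invisible to the form.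
\<close>

lemma form_compress:
  assumes "\<And>b. b \<le> n \<Longrightarrow> act E (y b) = y b"
  shows "hankel_form q (\<lambda>i. f (i + d)) n y = hankel_form q (\<lambda>i. act (c (i + d))) n y"
  unfolding hankel_form_def
proof (rule sum.cong)
  fix j assume "j \<in> {..n}"
  have "hankel_apply (\<lambda>i. f (i + d)) n y j = act E (hankel_apply (\<lambda>i. act (c (i + d))) n y j)"
    unfolding hankel_apply_def act_sum f_def by (rule sum.cong) (simp_all add: assms)
  then show "ip q (hankel_apply (\<lambda>i. f (i + d)) n y j) (y j) = ip q (hankel_apply (\<lambda>i. act (c (i + d))) n y j) (y j)"
    using assms \<open>j \<in> {..n}\<close> by (simp add: ip_E)
qed simp

lemma act_neg_V: "(\<lambda>i. act (- V (i + d))) = (\<lambda>i. - g (i + d))"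
  by (intro ext) (simp add: act_uminus_mat g_def)

lemma hankel_form_shifted:
  "hankel_form q (\<lambda>i. act (- V (i + 1))) n x = hankel_form q (\<lambda>i. act (c (i + 1))) n (upper_toeplitz n g x)"
proof -
  have "hankel_form q (\<lambda>i. - g (i + 1)) n x = hankel_form q (\<lambda>i. f (i + 1)) n (upper_toeplitz n g x)"
    unfolding hankel_form_def by (rule form_lift) (rule hankel_apply_shifted)
  then show ?thesis unfolding act_neg_V by (subst (asm) form_compress) (simp_all add: E_upper_toeplitz)
qed

text \<open>
  The vector is extended by a zero first block, which removes the block $V_0$ from the block diagonal matrix.
\<close>

lemma hankel_form_unshifted:
  "hankel_form q (\<lambda>i. act (- V (i + 2))) n x = hankel_form q (\<lambda>i. act (c i)) (Suc n) (upper_toeplitz (Suc n) g (case_nat 0 x))"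
proof -
  let ?x = "case_nat 0 x :: nat \<Rightarrow> nat \<Rightarrow> complex"
  let ?t = "\<lambda>j. \<Sum>a\<le>j. g (j - a) (hankel_apply f (Suc n) (upper_toeplitz (Suc n) g ?x) a)"
  have "hankel_form q (\<lambda>i. - g (i + 2)) n x = (\<Sum>j\<le>n. ip q (?t (Suc j)) (?x (Suc j)))"
    unfolding hankel_form_def using hankel_apply_unshifted[of n ?x] by simp
  also have "\<dots> = (\<Sum>j\<le>Suc n. ip q (?t j) (?x j))"
    unfolding sum.atMost_Suc_shift[of _ n] by simp
  also have "\<dots> = hankel_form q f (Suc n) (upper_toeplitz (Suc n) g ?x)"
    unfolding hankel_form_def by (rule form_lift) (rule refl)
  finally show ?thesis unfolding act_neg_V using form_compress[of "Suc n" "upper_toeplitz (Suc n) g ?x" 0] by (simp add: E_upper_toeplitz)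
qed

text \<open>
  When $E$ acts as the identity, the Toeplitz matrix of $f$ is a left inverse of that of $g$.
\<close>

lemma upper_toeplitz_nonzero:
  assumes id: "\<And>x i. i < q \<Longrightarrow> act E x i = x i" and x: "\<exists>j\<le>n. \<exists>i<q. x j i \<noteq> 0"
  shows "\<exists>j\<le>n. \<exists>i<q. upper_toeplitz n g x j i \<noteq> 0"
proof (rule ccontr)
  assume neg: "\<not> ?thesis"
  have z: "upper_toeplitz n g x j = 0" if "j \<le> n" for j
  proof (rule ext)
    fix i
    show "upper_toeplitz n g x j i = 0 i"
    proof (cases "i < q")
      case False
      then show ?thesis by (simp add: upper_toeplitz_def sum_fun_apply g_def act_outside dims)
    qed (use neg that in auto)
  qed
  obtain j i where ji: "j \<le> n" "i < q" "x j i \<noteq> 0" using x by blast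
  have "upper_toeplitz n f (upper_toeplitz n g x) j = 0"
    unfolding upper_toeplitz_def[of n f] by (rule sum.neutral) (simp add: z f_def)
  then have "act E (x j) = 0" using upper_toeplitz_inverse_swapped[OF ji(1)] by simp
  then have "act E (x j) i = 0" by simp
  then show False using id ji by simp
qed

text \<open>
  The Toeplitz matrices of $f$ and $g$ are inverse to each other up to $E$. Given a kernel vector $z$ with last block
  $V_0 \xi$, the image of $z$ under the Toeplitz matrix of $f$ has the last block $E \xi$; adding
  $\xi - E \xi$, which all $V_i$ annihilate, corrects it to $\xi$. The Toeplitz matrix of $g$ takes this vector to
  $E z$. Replacing $z$ by $E z$ is harmless by domination, except in the corner of the Hankel matrix,
  where the last block of $z$ already lies in the range of $E$.
\<close>

lemma kernel_lift:
  assumes dom: "\<And>i x. i < 2 * n \<Longrightarrow> act (c (i + d)) (act E x) = act (c (i + d)) x"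
    and full: "full_kernel (\<lambda>i. act (c (i + d))) n"
  shows "\<exists>x. x n = \<xi> \<and> (\<forall>a\<le>n. hankel_apply (\<lambda>i. f (i + d)) n (upper_toeplitz n g x) a = 0)"
proof -
  obtain z where z: "z n = g 0 \<xi>" "\<And>j. j \<le> n \<Longrightarrow> hankel_apply (\<lambda>i. act (c (i + d))) n z j = 0"
    using full unfolding full_kernel_def by blast
  define x where "x k = upper_toeplitz n f z k + (if k = n then \<xi> - act E \<xi> else 0)" for k
  have f0g0: "f 0 (g 0 \<xi>) = act E \<xi>" using right[of 0 \<xi>] by simp
  have "x n = \<xi>" by (simp add: x_def upper_toeplitz_def z(1) f0g0)
  have ups: "upper_toeplitz n g x b = act E (z b)" if b: "b \<le> n" for b
  proof -
    have "g i (if k = n then \<xi> - act E \<xi> else 0) = 0" for i k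
      by (simp add: g_def act_diff act_VE)
    then have "upper_toeplitz n g x b = upper_toeplitz n g (upper_toeplitz n f z) b" by (simp add: upper_toeplitz_def[of n g] x_def g_add)
    then show ?thesis using upper_toeplitz_inverse[OF b] by simp
  qed
  have En: "act E (z n) = z n" unfolding z(1) g_def by (rule act_EV)
  have "hankel_apply (\<lambda>i. f (i + d)) n (upper_toeplitz n g x) a = 0" if a: "a \<le> n" for a
  proof -
    have "hankel_apply (\<lambda>i. f (i + d)) n (upper_toeplitz n g x) a = (\<Sum>b\<le>n. act E (act (c (a + b + d)) (z b)))"
      unfolding hankel_apply_def
    proof (rule sum.cong)
      fix b assume "b \<in> {..n}"
      then have b: "b \<le> n" by simp
      show "f (a + b + d) (upper_toeplitz n g x b) = act E (act (c (a + b + d)) (z b))"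
      proof (cases "a + b < 2 * n")
        case True
        then show ?thesis using dom by (simp only: f_def ups[OF b] act_EE)
      next
        case False
        then have "b = n" using a b by simp
        then show ?thesis unfolding f_def ups[OF b] act_EE using En by simp
      qed
    qed simp
    also have "\<dots> = act E (hankel_apply (\<lambda>i. act (c (i + d))) n z a)"
      by (simp only: hankel_apply_def act_sum)
    finally show ?thesis using z(2)[OF a] by (simp only: act_zero)
  qed
  with \<open>x n = \<xi>\<close> show ?thesis by blast
qed

lemma full_kernel_shifted:
  assumes "\<And>i x. i < 2 * n \<Longrightarrow> act (c (i + 1)) (act E x) = act (c (i + 1)) x"
    and "full_kernel (\<lambda>i. act (c (i + 1))) n"
  shows "full_kernel (\<lambda>i. act (- V (i + 1))) n"
  unfolding full_kernel_def act_neg_V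
proof
  fix \<xi>
  obtain x where x: "x n = \<xi>" "\<And>a. a \<le> n \<Longrightarrow> hankel_apply (\<lambda>i. f (i + 1)) n (upper_toeplitz n g x) a = 0"
    using kernel_lift[of n 1, OF assms] by blast
  have "hankel_apply (\<lambda>i. - g (i + 1)) n x j = 0" if "j \<le> n" for j
    unfolding hankel_apply_shifted
  proof (intro sum.neutral ballI)
    fix a assume "a \<in> {..j}"
    then have "a \<le> n" using that by simp
    then show "g (j - a) (hankel_apply (\<lambda>i. f (i + 1)) n (upper_toeplitz n g x) a) = 0" by (simp only: x(2) g_zero)
  qed
  with x(1) show "\<exists>z. z n = \<xi> \<and> (\<forall>j\<le>n. hankel_apply (\<lambda>i. - g (i + 1)) n z j = 0)" by blast
qed

lemma full_kernel_unshifted: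
  assumes dom: "\<And>i x. i < 2 * Suc n \<Longrightarrow> act (c i) (act E x) = act (c i) x"
    and full: "full_kernel (\<lambda>i. act (c i)) (Suc n)"
  shows "full_kernel (\<lambda>i. act (- V (i + 2))) n"
  unfolding full_kernel_def act_neg_V
proof
  fix \<xi>
  obtain x where x: "x (Suc n) = \<xi>" "\<And>a. a \<le> Suc n \<Longrightarrow> hankel_apply f (Suc n) (upper_toeplitz (Suc n) g x) a = 0"
    using kernel_lift[of "Suc n" 0 \<xi>] dom full by (simp only: add_0_right) blast
  have "hankel_apply (\<lambda>i. - g (i + 2)) n (\<lambda>k. x (Suc k)) j = 0" if "j \<le> n" for j
    unfolding hankel_apply_unshifted using that by (intro sum.neutral) (simp add: x(2) g_zero)
  with x(1) show "\<exists>z. z n = \<xi> \<and> (\<forall>j\<le>n. hankel_apply (\<lambda>i. - g (i + 2)) n z j = 0)"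
    by (intro exI[of _ "\<lambda>k. x (Suc k)"]) blast
qed

end

section \<open>The reciprocal sequences of a Hermitian sequence\<close>

text \<open>
  All members of the infinite sequence are Hermitian, so that no index bounds occur; finite sequences are extended by zero
  later.
\<close>

locale hermitian_sequence =
  fixes q :: nat and \<alpha> :: real and s :: "nat \<Rightarrow> complex mat"
  assumes s_carrier: "s i \<in> carrier_mat q q" and s_herm: "mat_adjoint (s i) = s i"
begin

definition "G = pinv (s 0)"
definition "E = s 0 * G"
definition "u = plus_transform q \<alpha> s"
definition "v = reciprocal q u"
text \<open>
  The reciprocal of $s$ itself: $u = (1 - \alpha z) s$ gives $s^{-1} = (1 - \alpha z) u^{-1}$, which is again
  a $[+,\alpha]$-transform.
\<close>

definition "w = plus_transform q \<alpha> v"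

lemmas G_props = pinv_hermitian[OF s_carrier[of 0] s_herm[of 0], folded G_def, folded E_def]

lemma s_dims [simp]: "dim_row (s i) = q" "dim_col (s i) = q"
  using s_carrier[of i] by auto

lemma G_dims [simp]: "dim_row G = q" "dim_col G = q"
  using G_props(1) by auto

lemma u_0: "u 0 = s 0"
  using s_carrier by (simp add: u_def plus_transform_def)

lemma u_Suc: "u (Suc i) = alpha_shift \<alpha> s i"
  by (simp add: u_def plus_transform_def alpha_shift_def)

lemma alpha_shift_carrier: "alpha_shift \<alpha> s i \<in> carrier_mat q q"
  unfolding alpha_shift_def using s_carrier by auto

lemma alpha_shift_herm: "mat_adjoint (alpha_shift \<alpha> s i) = alpha_shift \<alpha> s i"
  unfolding alpha_shift_def by (subst adjoint_add) (simp_all add: adjoint_smult_real s_herm del: of_real_minus)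

lemma u_carrier: "u i \<in> carrier_mat q q"
  by (cases i) (simp_all only: u_0 u_Suc s_carrier alpha_shift_carrier)

lemma u_herm: "mat_adjoint (u i) = u i"
  by (cases i) (simp_all only: u_0 u_Suc s_herm alpha_shift_herm)

lemma v_carrier: "v i \<in> carrier_mat q q"
  using G_props(1) by (cases i) (auto simp: v_def u_0 G_def[symmetric] mat_sum_def mem_carrier_mat_iff)

lemma v_dims [simp]: "dim_row (v i) = q" "dim_col (v i) = q"
  using v_carrier[of i] by auto

lemma u_dims [simp]: "dim_row (u i) = q" "dim_col (u i) = q"
  using u_carrier[of i] by auto

lemma act_E: "act E x = act (s 0) (act G x)"
  by (simp add: E_def act_mult)

lemma act_GG: "act E (act G x) = act G x" "act G (act E x) = act G x"
  and act_sE: "act (s 0) (act E x) = act (s 0) x"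
  and act_Es: "act E (act (s 0) x) = act (s 0) x"
  using arg_cong[OF G_props(3), of "\<lambda>M. act M x"] arg_cong[OF G_props(2), of "\<lambda>M. act M x"]
    arg_cong[OF G_props(4), of "\<lambda>M. act M x"] arg_cong[OF G_props(4), of "\<lambda>M. act M (act G x)"]
    arg_cong[OF G_props(4), of "\<lambda>M. act M (act (s 0) x)"]
    arg_cong[OF arg_cong[OF G_props(4), of "\<lambda>M. act M x"], of "act (s 0)"]
  by (simp_all add: act_mult E_def)

lemma act_v_0: "act (v 0) x = act G x"
  by (simp add: v_def u_0 G_def)

lemma E_dims [simp]: "dim_row E = q" "dim_col E = q"
  by (simp_all add: E_def)

lemma act_v_Suc: "act (v (Suc j)) x = - act G (\<Sum>l<Suc j. act (u (Suc j - l)) (act (v l) x))"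
proof -
  let ?M = "mat_sum q q (\<lambda>l. u (Suc j - l) * v l) {..<Suc j}"
  have "act ?M x = (\<Sum>l<Suc j. act (u (Suc j - l) * v l) x)"
    by (rule act_mat_sum) (simp add: mem_carrier_mat_iff)
  also have "\<dots> = (\<Sum>l<Suc j. act (u (Suc j - l)) (act (v l) x))"
    by (rule sum.cong) (simp_all only: act_mult u_dims v_dims)
  finally have M: "act ?M x = (\<Sum>l<Suc j. act (u (Suc j - l)) (act (v l) x))" .
  have "act (v (Suc j)) x = act (- G * ?M) x" by (simp only: v_def reciprocal.simps u_0 G_def)
  also have "\<dots> = - act G (act ?M x)"
    by (subst act_mult) (simp_all add: mat_sum_def act_uminus_mat)
  finally show ?thesis unfolding M .
qed

lemma act_Ev: "act E (act (v i) x) = act (v i) x"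
  by (cases i) (simp_all only: act_v_0 act_v_Suc act_GG act_uminus)

lemma act_vE: "act (v i) (act E x) = act (v i) x"
proof (induction i rule: less_induct)
  case (less i)
  show ?case
  proof (cases i)
    case 0
    then show ?thesis by (simp only: act_v_0 act_GG)
  next
    case (Suc j)
    have "(\<Sum>l<Suc j. act (u (Suc j - l)) (act (v l) (act E x))) = (\<Sum>l<Suc j. act (u (Suc j - l)) (act (v l) x))"
      by (rule sum.cong) (use less.IH Suc in simp_all)
    then show ?thesis unfolding Suc act_v_Suc by (simp only:)
  qed
qed

lemma E_props: "E \<in> carrier_mat q q" "mat_adjoint E = E" "E * E = E"
proof -
  show c: "E \<in> carrier_mat q q" by (simp add: mem_carrier_mat_iff)
  show "mat_adjoint E = E" by (rule G_props(5))
  show "E * E = E"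
  proof (rule mat_eqI_act[of _ q q])
    show "act (E * E) x = act E x" for x
      using act_mult[of E E x] by (simp only: act_E[of "act E x"] act_GG E_dims) (simp only: act_E)
  qed (simp_all add: mem_carrier_mat_iff)
qed

lemma Ev: "E * v i = v i" and vE: "v i * E = v i"
proof -
  show "E * v i = v i"
    by (rule mat_eqI_act[of _ q q]) (simp_all add: mem_carrier_mat_iff act_mult[of E] act_Ev)
  show "v i * E = v i"
    by (rule mat_eqI_act[of _ q q]) (simp_all add: mem_carrier_mat_iff act_mult[of _ E] act_vE)
qed

definition scl :: "complex \<Rightarrow> (nat \<Rightarrow> complex) \<Rightarrow> nat \<Rightarrow> complex" where
  "scl z x = (\<lambda>i. z * x i)"

lemma act_scl: "act A (scl z x) = scl z (act A x)"
  by (rule ext) (simp add: act_def scl_def sum_distrib_left mult_ac)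

abbreviation "\<beta> \<equiv> complex_of_real (- \<alpha>)"

lemma act_plus_transform_Suc:
  assumes "\<And>i. z i \<in> carrier_mat q q"
  shows "act (plus_transform q \<alpha> z (Suc i)) x = scl \<beta> (act (z i) x) + act (z (Suc i)) x"
  using assms[of i] assms[of "Suc i"]
  by (simp add: plus_transform_def act_plus_mat act_smult_mat scl_def)

lemma plus_transform_0: "z 0 \<in> carrier_mat q q \<Longrightarrow> plus_transform q \<alpha> z 0 = z 0"
  by (simp add: plus_transform_def)

lemma plus_transform_carrier: "(\<And>i. z i \<in> carrier_mat q q) \<Longrightarrow> plus_transform q \<alpha> z j \<in> carrier_mat q q"
  by (cases j) (auto simp: plus_transform_def)

lemma w_dims [simp]: "dim_row (w i) = q" "dim_col (w i) = q"
  using plus_transform_carrier[of v i, OF v_carrier] by (auto simp: w_def)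

lemma act_w_0: "act (w 0) x = act (v 0) x"
  by (simp only: w_def plus_transform_0[of v, OF v_carrier])

lemmas act_w_Suc = act_plus_transform_Suc[of v, OF v_carrier, folded w_def]
lemmas act_u_Suc = act_plus_transform_Suc[of s, OF s_carrier, folded u_def]

text \<open>
  Multiplying the recursion of $v$ by $s_0$ from the left turns $s_0^\dagger$ into $E$; this is the convolution identity for
  the compressed sequence.
\<close>

lemma conv_u: "(\<Sum>l\<le>j. act E (act (u (j - l)) (act E (act (v l) x)))) = (if j = 0 then act E x else 0)"
proof (cases j)
  case 0
  have "act E (act (u 0) (act E (act (v 0) x))) = act E x"
    unfolding act_Ev act_v_0 u_0 act_Es act_GG by (rule act_E[symmetric])
  then show ?thesis using 0 by simp
next
  case (Suc i)
  define S where "S = (\<Sum>l<Suc i. act (u (Suc i - l)) (act (v l) x))"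
  have "(\<Sum>l\<le>j. act E (act (u (j - l)) (act E (act (v l) x))))
      = act E (\<Sum>l<Suc i. act (u (Suc i - l)) (act (v l) x)) + act E (act (u 0) (act (v (Suc i)) x))"
    unfolding act_Ev act_sum Suc lessThan_Suc_atMost[symmetric] sum.lessThan_Suc[of _ "Suc i"] diff_self_eq_0 ..
  also have "\<dots> = act E S + act E (- act E S)"
    unfolding u_0 act_v_Suc S_def[symmetric] act_uminus unfolding act_E[of S] ..
  also have "\<dots> = act E S - act E (act E S)" by (simp add: act_uminus)
  also have "act E (act E S) = act E S" using act_mult[of E E S] by (simp add: E_props)
  also have "act E S - act E S = 0" by (rule diff_self)
  finally have "(\<Sum>l\<le>j. act E (act (u (j - l)) (act E (act (v l) x)))) = 0" .
  moreover have "j \<noteq> 0" using Suc by simp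
  ultimately show ?thesis by (simp only: if_False)
qed

text \<open>
  The factor $1 - \alpha z$ is moved from $v$ to $s$, where it produces $u$.
\<close>

lemma conv_w: "(\<Sum>l\<le>j. act E (act (s (j - l)) (act E (act (w l) x)))) = (if j = 0 then act E x else 0)"
proof (cases j)
  case 0
  then show ?thesis using conv_u[of 0 x] by (simp add: act_w_0 u_0)
next
  case (Suc i)
  define F where "F k y = act E (act (s k) (act E y))" for k y
  have F_add: "F k (y + z) = F k y + F k z" and F_scl: "F k (scl a y) = scl a (F k y)" for k y z a
    by (simp_all add: F_def act_add act_scl)
  let ?X = "(\<Sum>l\<le>i. scl \<beta> (F (i - l) (act (v l) x)))"
  have "(\<Sum>l\<le>Suc i. F (Suc i - l) (act (w l) x))
      = F (Suc i) (act (v 0) x) + (\<Sum>l\<le>i. scl \<beta> (F (i - l) (act (v l) x)) + F (i - l) (act (v (Suc l)) x))"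
    unfolding sum.atMost_Suc_shift[of _ i] act_w_0 act_w_Suc F_add F_scl by simp
  also have "\<dots> = ?X + (\<Sum>l\<le>Suc i. F (Suc i - l) (act (v l) x))"
    unfolding sum.atMost_Suc_shift[of _ i] by (simp add: sum.distrib algebra_simps)
  also have "\<dots> = (\<Sum>l\<le>i. scl \<beta> (F (i - l) (act (v l) x)) + F (Suc i - l) (act (v l) x)) + F 0 (act (v (Suc i)) x)"
    by (simp only: sum.distrib sum.atMost_Suc diff_self_eq_0 add.assoc)
  also have "\<dots> = (\<Sum>l\<le>Suc i. act E (act (u (Suc i - l)) (act E (act (v l) x))))"
  proof -
    have "scl \<beta> (F (i - l) y) + F (Suc i - l) y = act E (act (u (Suc i - l)) (act E y))" if "l \<le> i" for l y
      using act_u_Suc[of "i - l" "act E y"] that by (simp only: Suc_diff_le F_def act_add act_scl)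
    then have "(\<Sum>l\<le>i. scl \<beta> (F (i - l) (act (v l) x)) + F (Suc i - l) (act (v l) x))
       = (\<Sum>l\<le>i. act E (act (u (Suc i - l)) (act E (act (v l) x))))" by (intro sum.cong) auto
    then show ?thesis by (simp only: sum.atMost_Suc diff_self_eq_0 F_def u_0)
  qed
  also have "\<dots> = 0" by (simp only: conv_u) simp
  finally show ?thesis using Suc by (simp add: F_def)
qed

sublocale U: hermitian_reciprocal q E u v
  by unfold_locales (fact E_props u_carrier u_herm v_carrier Ev vE conv_u)+

sublocale S: hermitian_reciprocal q E s w
proof unfold_locales
  show "w i \<in> carrier_mat q q" for i unfolding w_def by (rule plus_transform_carrier[OF v_carrier])
  have "act E (act (w i) x) = act (w i) x" "act (w i) (act E x) = act (w i) x" for i x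
    by (cases i; simp only: act_w_0 act_w_Suc act_add act_scl act_Ev act_vE)+
  then show "E * w i = w i" "w i * E = w i" for i
    by (intro mat_eqI_act[of _ q q]; simp add: mem_carrier_mat_iff act_mult[of E] act_mult[of _ E])+
qed (fact E_props s_carrier s_herm conv_w)+

section \<open>Hankel matrices of the transformed sequence\<close>

lemma step_eq: "alpha_step q \<alpha> s i = - v (i + 1)"
  by (simp only: alpha_step_def alpha_reciprocal_def v_def u_def)

lemma shift_step_eq: "alpha_shift \<alpha> (alpha_step q \<alpha> s) i = - w (i + 2)"
  unfolding alpha_shift_def step_eq w_def plus_transform_def
  by (rule eq_matI) (simp_all add: algebra_simps)

lemma step_carrier: "alpha_step q \<alpha> s i \<in> carrier_mat q q"
  unfolding step_eq by (simp add: mem_carrier_mat_iff)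

lemma shift_step_carrier: "alpha_shift \<alpha> (alpha_step q \<alpha> s) i \<in> carrier_mat q q"
  unfolding shift_step_eq by (simp add: mem_carrier_mat_iff)

lemma step_herm: "mat_adjoint (alpha_step q \<alpha> s i) = alpha_step q \<alpha> s i"
  unfolding step_eq adjoint_uminus U.V_herm ..

lemma shift_step_herm: "mat_adjoint (alpha_shift \<alpha> (alpha_step q \<alpha> s) i) = alpha_shift \<alpha> (alpha_step q \<alpha> s) i"
  unfolding shift_step_eq adjoint_uminus S.V_herm ..

lemma u_shift: "(\<lambda>i. act (u (i + 1))) = (\<lambda>i. act (alpha_shift \<alpha> s i))"
  by (simp add: u_Suc)

lemmas form_step = U.hankel_form_shifted[unfolded u_shift, folded step_eq]
lemmas form_shift_step = S.hankel_form_unshifted[folded shift_step_eq]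

lemma nonneg_step:
  assumes "nonneg_hermitian (block_hankel q (alpha_shift \<alpha> s) n)"
  shows "nonneg_hermitian (block_hankel q (alpha_step q \<alpha> s) n)"
proof -
  have "0 \<le> hankel_form q (\<lambda>i. act (alpha_shift \<alpha> s i)) n x" for x
    using assms nonneg_block_hankel_iff[of n "alpha_shift \<alpha> s" q] alpha_shift_carrier by blast
  then show ?thesis
    using nonneg_block_hankel_iff[of n "alpha_step q \<alpha> s" q] step_carrier step_herm form_step by simp
qed

lemma nonneg_shift_step:
  assumes "nonneg_hermitian (block_hankel q s (Suc n))"
  shows "nonneg_hermitian (block_hankel q (alpha_shift \<alpha> (alpha_step q \<alpha> s)) n)"
proof -
  have "0 \<le> hankel_form q (\<lambda>i. act (s i)) (Suc n) x" for x
    using assms nonneg_block_hankel_iff[of "Suc n" s q] s_carrier by blast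
  then show ?thesis
    using nonneg_block_hankel_iff[of n "alpha_shift \<alpha> (alpha_step q \<alpha> s)" q]
      shift_step_carrier shift_step_herm form_shift_step by simp
qed

lemma E_identity:
  assumes "pos_hermitian (s 0)" and i: "i < q"
  shows "act E x i = x i"
proof (rule ccontr)
  assume ne: "act E x i \<noteq> x i"
  let ?y = "x - act E x"
  have "\<exists>i<q. ?y i \<noteq> 0" using ne i by auto
  then have "0 < ip q (act (s 0) ?y) ?y" using assms(1) pos_hermitian_iff[OF s_carrier[of 0]] by blast
  moreover have "act (s 0) ?y = 0" by (simp add: act_diff act_sE)
  ultimately show False by (simp only: ip_zero order.irrefl)
qed

lemma pos_step:
  assumes s0: "pos_hermitian (s 0)" and pos: "pos_hermitian (block_hankel q (alpha_shift \<alpha> s) n)"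
  shows "pos_hermitian (block_hankel q (alpha_step q \<alpha> s) n)"
proof -
  have "0 < hankel_form q (\<lambda>i. act (alpha_shift \<alpha> s i)) n x" if "\<exists>j\<le>n. \<exists>i<q. x j i \<noteq> 0" for x
    using pos pos_block_hankel_iff[of n "alpha_shift \<alpha> s" q] alpha_shift_carrier that by blast
  then have "0 < hankel_form q (\<lambda>i. act (alpha_step q \<alpha> s i)) n x" if "\<exists>j\<le>n. \<exists>i<q. x j i \<noteq> 0" for x
    unfolding form_step using U.upper_toeplitz_nonzero[OF E_identity[OF s0] that] by blast
  then show ?thesis
    using pos_block_hankel_iff[of n "alpha_step q \<alpha> s" q] step_carrier step_herm by blast
qed

lemma pos_shift_step:
  assumes s0: "pos_hermitian (s 0)" and pos: "pos_hermitian (block_hankel q s (Suc n))"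
  shows "pos_hermitian (block_hankel q (alpha_shift \<alpha> (alpha_step q \<alpha> s)) n)"
proof -
  have p: "0 < hankel_form q (\<lambda>i. act (s i)) (Suc n) x" if "\<exists>j\<le>Suc n. \<exists>i<q. x j i \<noteq> 0" for x
    using pos pos_block_hankel_iff[of "Suc n" s q] s_carrier that by blast
  have "0 < hankel_form q (\<lambda>i. act (alpha_shift \<alpha> (alpha_step q \<alpha> s) i)) n x" if x: "\<exists>j\<le>n. \<exists>i<q. x j i \<noteq> 0" for x
  proof -
    obtain j i where "j \<le> n" "i < q" "x j i \<noteq> 0" using x by blast
    then have "Suc j \<le> Suc n" "i < q" "case_nat 0 x (Suc j) i \<noteq> 0" by simp_all
    then have "\<exists>j\<le>Suc n. \<exists>i<q. case_nat 0 x j i \<noteq> 0" by blast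
    from S.upper_toeplitz_nonzero[OF E_identity[OF s0] this] show ?thesis unfolding form_shift_step by (rule p)
  qed
  then show ?thesis
    using pos_block_hankel_iff[of n "alpha_shift \<alpha> (alpha_step q \<alpha> s)" q]
      shift_step_carrier shift_step_herm by blast
qed

text \<open>
  The vector $x - E x$ lies in the kernel of $s_0$.
\<close>

lemma compress_dominated:
  assumes "\<And>y. act (s 0) y = 0 \<Longrightarrow> act A y = 0"
  shows "act A (act E x) = act A x"
proof -
  have "act (s 0) (x - act E x) = 0" by (simp add: act_diff act_sE)
  from assms[OF this] show ?thesis by (simp add: act_diff)
qed

text \<open>
  The kernel of $s_0$ is contained in that of $s_j$ for $j < 2n$ by domination in $H_n$; in particular it is contained in the
  kernel of $s_{\alpha,0}$, and domination in $H_{\alpha,n}$ carries on from there.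
\<close>

lemma schur_step:
  assumes nn: "nonneg_hermitian (block_hankel q s n)"
    and nns: "nonneg_hermitian (block_hankel q (alpha_shift \<alpha> s) n)"
    and z: "hankel_schur q (alpha_shift \<alpha> s) n = 0\<^sub>m q q"
  shows "hankel_schur q (alpha_step q \<alpha> s) n = 0\<^sub>m q q"
proof -
  have dom: "act (alpha_shift \<alpha> s i) y = 0" if y: "act (s 0) y = 0" and i: "i < 2 * n" for i y
  proof (rule hankel_dominance[OF _ nns _ i])
    have "1 < 2 * n" using i by (cases n) simp_all
    then have "act (s 1) y = 0" using hankel_dominance[OF _ nn y, of 1] s_carrier by simp
    then show "act (alpha_shift \<alpha> s 0) y = 0"
      using act_u_Suc[of 0 y] y by (simp add: u_Suc scl_def fun_eq_iff)
  qed (simp add: alpha_shift_carrier)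
  have "full_kernel (\<lambda>i. act (alpha_shift \<alpha> s i)) n"
    using z hankel_schur_eq_0_iff[OF _ nns] alpha_shift_carrier by blast
  then have "full_kernel (\<lambda>i. act (u (i + 1))) n" unfolding u_shift .
  then have "full_kernel (\<lambda>i. act (- v (i + 1))) n"
  proof (rule U.full_kernel_shifted[rotated])
    fix i x assume "i < 2 * n"
    then have "act (u (i + 1)) y = 0" if "act (s 0) y = 0" for y using dom[OF that] by (simp add: u_Suc)
    then show "act (u (i + 1)) (act E x) = act (u (i + 1)) x" by (rule compress_dominated)
  qed
  then show ?thesis
    using hankel_schur_eq_0_iff[OF _ nonneg_step[OF nns]] step_carrier unfolding step_eq by blast
qed

lemma schur_shift_step:
  assumes nn: "nonneg_hermitian (block_hankel q s (Suc n))"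
    and z: "hankel_schur q s (Suc n) = 0\<^sub>m q q"
  shows "hankel_schur q (alpha_shift \<alpha> (alpha_step q \<alpha> s)) n = 0\<^sub>m q q"
proof -
  have "full_kernel (\<lambda>i. act (s i)) (Suc n)"
    using z hankel_schur_eq_0_iff[OF _ nn] s_carrier by blast
  then have "full_kernel (\<lambda>i. act (- w (i + 2))) n"
  proof (rule S.full_kernel_unshifted[rotated])
    fix i x assume i: "i < 2 * Suc n"
    have "act (s i) y = 0" if "act (s 0) y = 0" for y
      by (rule hankel_dominance[OF _ nn that i]) (simp add: s_carrier)
    then show "act (s i) (act E x) = act (s i) x" by (rule compress_dominated)
  qed
  then show ?thesis
    using hankel_schur_eq_0_iff[OF _ nonneg_shift_step[OF nn]] shift_step_carrier
    unfolding shift_step_eq by blast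
qed

end

section \<open>The classes of sequences\<close>

lemma block_matrix_cong:
  assumes "\<And>j k. j < m \<Longrightarrow> k < n \<Longrightarrow> B j k = B' j k"
  shows "block_matrix q m n B = block_matrix q m n B'"
  unfolding block_matrix_def
  by (rule cong_mat) (use assms in \<open>auto simp: less_mult_imp_div_less\<close>)

lemma block_hankel_cong:
  assumes "\<And>i. i \<le> 2 * n \<Longrightarrow> s i = s' i"
  shows "block_hankel q s n = block_hankel q s' n"
  unfolding block_hankel_def by (rule block_matrix_cong) (use assms in auto)

lemma hankel_schur_cong:
  assumes "\<And>i. i \<le> 2 * n \<Longrightarrow> s i = s' i"
  shows "hankel_schur q s n = hankel_schur q s' n"
proof (cases n)
  case 0
  then show ?thesis using assms by (simp add: hankel_schur_def)
next
  case (Suc m)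
  have "block_matrix q 1 n (\<lambda>_ k. s (n + k)) = block_matrix q 1 n (\<lambda>_ k. s' (n + k))"
    "block_matrix q n 1 (\<lambda>j _. s (n + j)) = block_matrix q n 1 (\<lambda>j _. s' (n + j))"
    "block_hankel q s (n - 1) = block_hankel q s' (n - 1)"
    by (rule block_matrix_cong block_hankel_cong; use assms in simp)+
  then show ?thesis unfolding hankel_schur_def using assms[of "2 * n"] assms[of 0] by simp
qed

lemma alpha_shift_cong: "s i = s' i \<Longrightarrow> s (i + 1) = s' (i + 1) \<Longrightarrow> alpha_shift \<alpha> s i = alpha_shift \<alpha> s' i"
  by (simp add: alpha_shift_def)

lemma reciprocal_cong: "(\<And>i. i \<le> j \<Longrightarrow> u i = u' i) \<Longrightarrow> reciprocal q u j = reciprocal q u' j"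
proof (induction j rule: less_induct)
  case (less j)
  show ?case
  proof (cases j)
    case 0
    then show ?thesis using less.prems by simp
  next
    case (Suc i)
    have "mat_sum q q (\<lambda>l. u (Suc i - l) * reciprocal q u l) {..<Suc i}
      = mat_sum q q (\<lambda>l. u' (Suc i - l) * reciprocal q u' l) {..<Suc i}"
    proof (rule mat_sum_cong)
      fix l assume "l \<in> {..<Suc i}"
      then have l: "l < j" using Suc by simp
      have "reciprocal q u l = reciprocal q u' l" by (rule less.IH[OF l]) (use l less.prems in simp)
      moreover have "u (Suc i - l) = u' (Suc i - l)" using less.prems Suc by simp
      ultimately show "u (Suc i - l) * reciprocal q u l = u' (Suc i - l) * reciprocal q u' l" by simp
    qed simp
    then show ?thesis using less.prems[of 0] Suc by simp
  qed
qed

lemma alpha_step_cong: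
  assumes "\<And>i. i \<le> Suc j \<Longrightarrow> s i = s' i"
  shows "alpha_step q \<alpha> s j = alpha_step q \<alpha> s' j"
proof -
  have "plus_transform q \<alpha> s i = plus_transform q \<alpha> s' i" if "i \<le> Suc j" for i
    using that assms[of i] assms[of "i - 1"] by (cases i) (auto simp: plus_transform_def)
  then show ?thesis 
    unfolding alpha_step_def alpha_reciprocal_def
    by (subst reciprocal_cong[of _ _ "plus_transform q \<alpha> s'"]) simp_all
qed

lemma block_hankel_0: "s 0 \<in> carrier_mat q q \<Longrightarrow> block_hankel q s 0 = s 0"
  by (rule eq_matI) (auto simp: block_hankel_def block_matrix_def)

lemma half_pred_odd: "odd m \<Longrightarrow> (m - 1) div 2 = m div 2"
  for m :: nat
  by (erule oddE) simp

lemma half_pred_even: "even m \<Longrightarrow> (m - 1) div 2 = m div 2 - 1"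
  for m :: nat
proof (erule evenE)
  fix b assume "m = 2 * b"
  then show ?thesis by (cases b) simp_all
qed

lemma half_pred_pred:
  assumes "0 < m - 1"
  shows "m div 2 = Suc ((m - 1 - 1) div 2)"
proof -
  obtain k where "m = Suc (Suc k)" using assms by (metis Suc_diff_1 diff_0_eq_0 diff_is_0_eq less_numeral_extra(3) not_gr_zero)
  then show ?thesis by simp
qed

text \<open>
  The parities of $m$ in the definition of the classes, expressed uniformly by integer division.
\<close>

lemma K_finite_iff:
  "s \<in> K_finite Q q \<alpha> m \<longleftrightarrow> (\<forall>j\<le>m. s j \<in> carrier_mat q q) \<and> Q (block_hankel q s (m div 2)) \<and>
    (0 < m \<longrightarrow> Q (block_hankel q (alpha_shift \<alpha> s) ((m - 1) div 2)))"
  using half_pred_odd[of m] half_pred_even[of m]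
  by (cases "m = 0"; cases "even m") (auto simp: K_finite_def block_hankel_0)

lemma K_finite_cong:
  assumes "\<And>j. j \<le> m \<Longrightarrow> s j = s' j"
  shows "s \<in> K_finite Q q \<alpha> m \<longleftrightarrow> s' \<in> K_finite Q q \<alpha> m"
proof -
  have "block_hankel q s (m div 2) = block_hankel q s' (m div 2)"
    by (rule block_hankel_cong) (use assms in simp)
  moreover have "block_hankel q (alpha_shift \<alpha> s) ((m - 1) div 2) = block_hankel q (alpha_shift \<alpha> s') ((m - 1) div 2)"
    if "0 < m" by (rule block_hankel_cong, rule alpha_shift_cong) (use assms that in simp_all)
  ultimately show ?thesis using assms by (auto simp: K_finite_iff)
qed

text \<open>
  For odd $m$ the last matrix does not occur in $H_n$; it is Hermitian because $s_{\alpha,m-1}$ is.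
\<close>

lemma K_finite_hermitian:
  assumes Q: "\<And>A. Q A \<Longrightarrow> mat_adjoint A = A" and s: "s \<in> K_finite Q q \<alpha> m" and j: "j \<le> m"
  shows "mat_adjoint (s j) = s j"
proof -
  have c: "\<forall>j\<le>m. s j \<in> carrier_mat q q" and H: "Q (block_hankel q s (m div 2))"
    and Hs: "0 < m \<Longrightarrow> Q (block_hankel q (alpha_shift \<alpha> s) ((m - 1) div 2))"
    using s by (auto simp: K_finite_iff)
  have h: "mat_adjoint (s i) = s i" if "i \<le> 2 * (m div 2)" for i
    using block_hankel_hermitian_iff[of "m div 2" s q] Q[OF H] c that by simp
  show ?thesis
  proof (cases "j \<le> 2 * (m div 2)")
    case True
    then show ?thesis by (rule h)
  next
    case False
    then have m: "m = 2 * (m div 2) + 1" "j = m"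
      using j div_mult_mod_eq[of m 2] mod_less_divisor[of 2 m] by linarith+
    define i where "i = 2 * (m div 2)"
    have i: "i \<le> 2 * ((m - 1) div 2)" "i \<le> 2 * (m div 2)" "j = i + 1" "0 < m" using m by (simp_all add: i_def)
    have "\<forall>i\<le>2 * ((m - 1) div 2). alpha_shift \<alpha> s i \<in> carrier_mat q q"
      using c i(4) by (auto simp: alpha_shift_def)
    then have a: "mat_adjoint (alpha_shift \<alpha> s i) = alpha_shift \<alpha> s i"
      using block_hankel_hermitian_iff[of "(m - 1) div 2" "alpha_shift \<alpha> s" q] Q[OF Hs] i by blast
    have ci: "s i \<in> carrier_mat q q" "s j \<in> carrier_mat q q" using c i m by auto
    show ?thesis
    proof (rule eq_matI)
      fix a b assume "a < dim_row (s j)" "b < dim_col (s j)"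
      then have ab: "a < q" "b < q" using ci by auto
      have "cnj (s i $$ (b, a)) = s i $$ (a, b)"
        using adjoint_index[of a "s i" b] h[OF i(2)] ab ci by simp
      moreover have "cnj (alpha_shift \<alpha> s i $$ (b, a)) = alpha_shift \<alpha> s i $$ (a, b)"
        using adjoint_index[of a "alpha_shift \<alpha> s i" b] a ab ci i(3) by (simp add: alpha_shift_def)
      ultimately show "mat_adjoint (s j) $$ (a, b) = s j $$ (a, b)"
        using ab ci i(3) by (simp add: adjoint_index alpha_shift_def)
    qed (use ci in auto)
  qed
qed

text \<open>
  Zero is Hermitian, so this turns a finite sequence of a class into an infinite Hermitian sequence
  with the same transform up to index $m - 1$.
\<close>

definition truncate_seq :: "nat \<Rightarrow> nat \<Rightarrow> (nat \<Rightarrow> complex mat) \<Rightarrow> nat \<Rightarrow> complex mat" where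
  "truncate_seq q m s j = (if j \<le> m then s j else 0\<^sub>m q q)"

lemma truncate_hermitian_sequence:
  assumes "\<And>A. Q A \<Longrightarrow> mat_adjoint A = A" "s \<in> K_finite Q q \<alpha> m"
  shows "hermitian_sequence q (truncate_seq q m s)"
proof
  show "truncate_seq q m s i \<in> carrier_mat q q" for i using assms(2) by (simp add: truncate_seq_def K_finite_iff)
  show "mat_adjoint (truncate_seq q m s i) = truncate_seq q m s i" for i
    using K_finite_hermitian[OF assms, of i] by (simp add: truncate_seq_def)
qed

lemma truncate_mem: "truncate_seq q m s \<in> K_finite Q q \<alpha> m \<longleftrightarrow> s \<in> K_finite Q q \<alpha> m"
  by (rule K_finite_cong) (simp add: truncate_seq_def)

lemma truncate_step: "j < m \<Longrightarrow> alpha_step q \<alpha> (truncate_seq q m s) j = alpha_step q \<alpha> s j"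
  by (rule alpha_step_cong) (simp add: truncate_seq_def)

lemma truncate_step_mem:
  assumes "0 < m"
  shows "alpha_step q \<alpha> (truncate_seq q m s) \<in> K_finite Q q \<alpha> (m - 1) \<longleftrightarrow> alpha_step q \<alpha> s \<in> K_finite Q q \<alpha> (m - 1)"
  by (rule K_finite_cong) (use assms in \<open>simp add: truncate_step\<close>)

lemma step_K_nonneg:
  assumes m: "0 < m" and s: "s \<in> K_finite nonneg_hermitian q \<alpha> m"
  shows "alpha_step q \<alpha> s \<in> K_finite nonneg_hermitian q \<alpha> (m - 1)"
proof -
  let ?s = "truncate_seq q m s"
  interpret hermitian_sequence q \<alpha> ?s
    by (rule truncate_hermitian_sequence[OF _ s]) (simp add: nonneg_hermitian_def)
  have s': "?s \<in> K_finite nonneg_hermitian q \<alpha> m" using s by (simp only: truncate_mem)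
  have "alpha_step q \<alpha> ?s \<in> K_finite nonneg_hermitian q \<alpha> (m - 1)"
    unfolding K_finite_iff
  proof (intro conjI impI allI)
    show "nonneg_hermitian (block_hankel q (alpha_step q \<alpha> ?s) ((m - 1) div 2))"
      by (rule nonneg_step) (use s' m in \<open>simp add: K_finite_iff\<close>)
    assume "0 < m - 1"
    then have "m div 2 = Suc ((m - 1 - 1) div 2)" by (rule half_pred_pred)
    then show "nonneg_hermitian (block_hankel q (alpha_shift \<alpha> (alpha_step q \<alpha> ?s)) ((m - 1 - 1) div 2))"
      using s' by (intro nonneg_shift_step) (simp add: K_finite_iff)
  qed (rule step_carrier)
  then show ?thesis unfolding truncate_step_mem[OF m] .
qed

lemma pos_block_hankel_first:
  assumes "\<forall>i\<le>2 * n. s i \<in> carrier_mat q q" "pos_hermitian (block_hankel q s n)"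
  shows "pos_hermitian (s 0)"
proof -
  have c: "s 0 \<in> carrier_mat q q" using assms(1) by simp
  have H: "mat_adjoint (s 0) = s 0" "\<And>x. (\<exists>j\<le>n. \<exists>i<q. x j i \<noteq> 0) \<Longrightarrow> 0 < hankel_form q (\<lambda>i. act (s i)) n x"
    using assms(2) pos_block_hankel_iff[OF assms(1)] by auto
  have "0 < ip q (act (s 0) x) x" if "\<exists>i<q. x i \<noteq> 0" for x
  proof -
    define y where "y = (\<lambda>j::nat. if j = 0 then x else 0)"
    have "hankel_apply (\<lambda>i. act (s i)) n y 0 = (\<Sum>k\<le>n. if k = 0 then act (s 0) x else 0)"
      unfolding hankel_apply_def y_def by (intro sum.cong) auto
    then have "hankel_apply (\<lambda>i. act (s i)) n y 0 = act (s 0) x" by simp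
    then have "hankel_form q (\<lambda>i. act (s i)) n y = (\<Sum>j\<le>n. if j = 0 then ip q (act (s 0) x) x else 0)"
      unfolding hankel_form_def by (intro sum.cong) (auto simp: y_def)
    moreover have "\<exists>j\<le>n. \<exists>i<q. y j i \<noteq> 0" using that by (intro exI[of _ 0]) (simp add: y_def)
    ultimately show ?thesis using H(2)[of y] by simp
  qed
  then show ?thesis using pos_hermitian_iff[OF c] H(1) by blast
qed

lemma step_K_pos:
  assumes m: "0 < m" and s: "s \<in> K_finite pos_hermitian q \<alpha> m"
  shows "alpha_step q \<alpha> s \<in> K_finite pos_hermitian q \<alpha> (m - 1)"
proof -
  let ?s = "truncate_seq q m s"
  interpret hermitian_sequence q \<alpha> ?s
    by (rule truncate_hermitian_sequence[OF _ s]) (simp add: pos_hermitian_def)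
  have s': "?s \<in> K_finite pos_hermitian q \<alpha> m" using s by (simp only: truncate_mem)
  have s0: "pos_hermitian (?s 0)"
    by (rule pos_block_hankel_first[of "m div 2" ?s q]) (use s' s_carrier in \<open>simp_all add: K_finite_iff\<close>)
  have "alpha_step q \<alpha> ?s \<in> K_finite pos_hermitian q \<alpha> (m - 1)"
    unfolding K_finite_iff
  proof (intro conjI impI allI)
    show "pos_hermitian (block_hankel q (alpha_step q \<alpha> ?s) ((m - 1) div 2))"
      by (rule pos_step[OF s0]) (use s' m in \<open>simp add: K_finite_iff\<close>)
    assume "0 < m - 1"
    then have "m div 2 = Suc ((m - 1 - 1) div 2)" by (rule half_pred_pred)
    then show "pos_hermitian (block_hankel q (alpha_shift \<alpha> (alpha_step q \<alpha> ?s)) ((m - 1 - 1) div 2))"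
      using s' by (intro pos_shift_step[OF s0]) (simp add: K_finite_iff)
  qed (rule step_carrier)
  then show ?thesis unfolding truncate_step_mem[OF m] .
qed

lemma K_cd_finite_cong:
  assumes "\<And>j. j \<le> m \<Longrightarrow> s j = s' j"
  shows "s \<in> K_cd_finite q \<alpha> m \<longleftrightarrow> s' \<in> K_cd_finite q \<alpha> m"
proof -
  have "hankel_schur q s (m div 2) = hankel_schur q s' (m div 2)"
    by (rule hankel_schur_cong) (use assms in simp)
  moreover have "hankel_schur q (alpha_shift \<alpha> s) (m div 2) = hankel_schur q (alpha_shift \<alpha> s') (m div 2)" if "odd m"
  proof (rule hankel_schur_cong, rule alpha_shift_cong)
    fix i assume "i \<le> 2 * (m div 2)"
    then have "i \<le> m" "i + 1 \<le> m" using that by (auto elim!: oddE)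
    then show "s i = s' i" "s (i + 1) = s' (i + 1)" using assms by blast+
  qed
  ultimately show ?thesis
    using K_finite_cong[OF assms, where Q = nonneg_hermitian and q = q and \<alpha> = \<alpha>]
    by (auto simp: K_cd_finite_def K_nonneg_def K_class_def)
qed

lemma step_K_cd:
  assumes m: "0 < m" and s: "s \<in> K_cd_finite q \<alpha> m"
  shows "alpha_step q \<alpha> s \<in> K_cd_finite q \<alpha> (m - 1)"
proof -
  let ?s = "truncate_seq q m s"
  have sK: "s \<in> K_finite nonneg_hermitian q \<alpha> m"
    using s by (simp add: K_cd_finite_def K_nonneg_def K_class_def)
  interpret hermitian_sequence q \<alpha> ?s
    by (rule truncate_hermitian_sequence[OF _ sK]) (simp add: nonneg_hermitian_def)
  have s': "?s \<in> K_cd_finite q \<alpha> m"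
    using s K_cd_finite_cong[of m ?s s q \<alpha>] by (simp add: truncate_seq_def)
  have K: "?s \<in> K_finite nonneg_hermitian q \<alpha> m" using sK by (simp only: truncate_mem)
  have nn: "nonneg_hermitian (block_hankel q ?s (m div 2))"
    and nns: "nonneg_hermitian (block_hankel q (alpha_shift \<alpha> ?s) ((m - 1) div 2))"
    using K m by (simp_all add: K_finite_iff)
  have Tn: "alpha_step q \<alpha> ?s \<in> K_finite nonneg_hermitian q \<alpha> (m - 1)" by (rule step_K_nonneg[OF m K])
  have "alpha_step q \<alpha> ?s \<in> K_cd_finite q \<alpha> (m - 1)"
  proof (cases "even m")
    case True
    define n where "n = (m - 1) div 2"
    obtain b where "m = 2 * b" using True by (rule evenE)
    then have n: "m div 2 = Suc n" "odd (m - 1)" using m by (cases b; simp add: n_def)+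
    have "hankel_schur q ?s (Suc n) = 0\<^sub>m q q" using s' True n by (simp add: K_cd_finite_def)
    then have "hankel_schur q (alpha_shift \<alpha> (alpha_step q \<alpha> ?s)) n = 0\<^sub>m q q"
      using nn n by (intro schur_shift_step) simp_all
    then show ?thesis using Tn n by (simp add: K_cd_finite_def K_nonneg_def K_class_def n_def)
  next
    case False
    then have n: "m div 2 = (m - 1) div 2" "even (m - 1)" using half_pred_odd[OF False] by simp_all
    have "hankel_schur q (alpha_shift \<alpha> ?s) ((m - 1) div 2) = 0\<^sub>m q q" using s' False n by (simp add: K_cd_finite_def)
    then have "hankel_schur q (alpha_step q \<alpha> ?s) ((m - 1) div 2) = 0\<^sub>m q q"
      using nn nns n by (intro schur_step) simp_all
    then show ?thesis using Tn n by (simp add: K_cd_finite_def K_nonneg_def K_class_def)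
  qed
  moreover have "alpha_step q \<alpha> ?s j = alpha_step q \<alpha> s j" if "j \<le> m - 1" for j
    by (rule truncate_step) (use that m in simp)
  ultimately show ?thesis using K_cd_finite_cong[of "m - 1" "alpha_step q \<alpha> ?s" "alpha_step q \<alpha> s" q \<alpha>] by blast
qed

lemma pinv_zero: "pinv (0\<^sub>m q q) = 0\<^sub>m q q"
  by (rule pinv_eqI) (simp add: moore_penrose_def)

text \<open>
  For $m = 0$ the hypothesis says $s_0 = 0$, and then the whole transformed sequence vanishes.
\<close>

lemma step_K_cd_0:
  assumes s: "s \<in> K_cd_finite q \<alpha> 0"
  shows "alpha_step q \<alpha> s \<in> K_cd_finite q \<alpha> 0"
proof -
  have s0: "s 0 = 0\<^sub>m q q" using s by (simp add: K_cd_finite_def hankel_schur_def)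
  then have "plus_transform q \<alpha> s 0 = 0\<^sub>m q q" by (simp add: plus_transform_def)
  then have "alpha_step q \<alpha> s 0 = 0\<^sub>m q q"
    by (simp add: alpha_step_def alpha_reciprocal_def pinv_zero mat_sum_def)
  moreover have "nonneg_hermitian (0\<^sub>m q q)"
    using nonneg_hermitian_iff[of "0\<^sub>m q q" q] by simp
  ultimately show ?thesis
    by (simp add: K_cd_finite_def K_nonneg_def K_class_def K_finite_def hankel_schur_def)
qed

theorem proposition6p13:
  fixes q :: nat and \<alpha> :: real and \<kappa> :: enat and s :: "nat \<Rightarrow> complex mat"
  assumes "q \<ge> 1" and "\<kappa> \<ge> 1"
    and "\<And>j. enat j \<le> \<kappa> \<Longrightarrow> s j \<in> carrier_mat q q"
  shows "(s \<in> K_nonneg q \<alpha> \<kappa> \<longrightarrow> alpha_step q \<alpha> s \<in> K_nonneg q \<alpha> (\<kappa> - 1)) \<and>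
    (s \<in> K_nonneg_ext q \<alpha> \<kappa> \<longrightarrow> alpha_step q \<alpha> s \<in> K_nonneg_ext q \<alpha> (\<kappa> - 1)) \<and>
    (s \<in> K_pos q \<alpha> \<kappa> \<longrightarrow> alpha_step q \<alpha> s \<in> K_pos q \<alpha> (\<kappa> - 1)) \<and>
    (\<forall>m::nat. enat m \<le> \<kappa> \<longrightarrow> s \<in> K_cd_order q \<alpha> \<kappa> m \<longrightarrow>
       alpha_step q \<alpha> s \<in> K_cd_order q \<alpha> (\<kappa> - 1) (nat (max 0 (int m - 1)))) \<and>
    (s \<in> K_cd q \<alpha> \<kappa> \<longrightarrow> alpha_step q \<alpha> s \<in> K_cd q \<alpha> (\<kappa> - 1))"
proof -
  let ?T = "alpha_step q \<alpha> s"
  have cases_\<kappa>: "(\<exists>k. 0 < k \<and> \<kappa> = enat k \<and> \<kappa> - 1 = enat (k - 1)) \<or> (\<kappa> = \<infinity> \<and> \<kappa> - 1 = \<infinity>)"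
    using assms(2) by (cases \<kappa>) (auto simp: one_enat_def)
  have cd: "?T \<in> K_cd_finite q \<alpha> (m - 1)" if "s \<in> K_cd_finite q \<alpha> m" for m
    using step_K_cd[of m] step_K_cd_0 that by (cases "m = 0") auto
  have shift: "?T \<in> K_class Q q \<alpha> (\<kappa> - 1)"
    if step: "\<And>m. 0 < m \<Longrightarrow> s \<in> K_finite Q q \<alpha> m \<Longrightarrow> ?T \<in> K_finite Q q \<alpha> (m - 1)"
      and s: "s \<in> K_class Q q \<alpha> \<kappa>" for Q
    using cases_\<kappa>
  proof (elim disjE exE conjE)
    fix k assume "0 < k" "\<kappa> = enat k" "\<kappa> - 1 = enat (k - 1)"
    then show ?thesis using step[of k] s by (simp add: K_class_def)
  next
    assume k: "\<kappa> = \<infinity>" "\<kappa> - 1 = \<infinity>"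
    have "?T \<in> K_finite Q q \<alpha> m" for m using step[of "Suc m"] s k by (simp add: K_class_def)
    then show ?thesis using k by (simp add: K_class_def)
  qed
  have a: "?T \<in> K_nonneg q \<alpha> (\<kappa> - 1)" if "s \<in> K_nonneg q \<alpha> \<kappa>"
    using shift[of nonneg_hermitian] step_K_nonneg that unfolding K_nonneg_def by blast
  have c: "?T \<in> K_pos q \<alpha> (\<kappa> - 1)" if "s \<in> K_pos q \<alpha> \<kappa>"
    using shift[of pos_hermitian] step_K_pos that unfolding K_pos_def by blast
  have b: "?T \<in> K_nonneg_ext q \<alpha> (\<kappa> - 1)" if s: "s \<in> K_nonneg_ext q \<alpha> \<kappa>"
    using cases_\<kappa>
  proof (elim disjE exE conjE)
    fix k assume k: "0 < k" "\<kappa> = enat k" "\<kappa> - 1 = enat (k - 1)"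
    then obtain S where S: "s(k + 1 := S) \<in> K_finite nonneg_hermitian q \<alpha> (k + 1)"
      using s by (auto simp: K_nonneg_ext_def K_nonneg_def K_class_def)
    \<comment> \<open>the transform of the extended sequence has one more member and extends the transform of \<open>s\<close>\<close>
    define T' where "T' = alpha_step q \<alpha> (s(k + 1 := S))"
    have T': "T' \<in> K_finite nonneg_hermitian q \<alpha> k" using step_K_nonneg[OF _ S] by (simp add: T'_def)
    have "(?T(k := T' k)) j = T' j" if "j \<le> k" for j
      using that unfolding T'_def by (cases "j = k") (auto intro!: alpha_step_cong)
    then have "?T(k := T' k) \<in> K_finite nonneg_hermitian q \<alpha> k"
      using K_finite_cong[of k "?T(k := T' k)" T'] T' by blast
    moreover have "T' k \<in> carrier_mat q q" using T' by (simp add: K_finite_iff)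
    ultimately show ?thesis using k by (auto simp: K_nonneg_ext_def K_nonneg_def K_class_def)
  next
    assume "\<kappa> = \<infinity>" "\<kappa> - 1 = \<infinity>"
    then show ?thesis using a s by (simp add: K_nonneg_ext_def)
  qed
  have d: "?T \<in> K_cd_order q \<alpha> (\<kappa> - 1) (nat (max 0 (int m - 1)))" if "s \<in> K_cd_order q \<alpha> \<kappa> m" for m
  proof -
    have "nat (max 0 (int m - 1)) = m - 1" by linarith
    then show ?thesis using that a cd[of m] by (simp add: K_cd_order_def)
  qed
  have e: "?T \<in> K_cd q \<alpha> (\<kappa> - 1)" if s: "s \<in> K_cd q \<alpha> \<kappa>"
    using cases_\<kappa>
  proof (elim disjE exE conjE)
    fix k assume "0 < k" "\<kappa> = enat k" "\<kappa> - 1 = enat (k - 1)"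
    then show ?thesis using s cd[of k] by (simp add: K_cd_def)
  next
    assume k: "\<kappa> = \<infinity>" "\<kappa> - 1 = \<infinity>"
    then obtain m where "s \<in> K_cd_finite q \<alpha> m" "s \<in> K_nonneg q \<alpha> \<infinity>" using s by (auto simp: K_cd_def)
    then show ?thesis using k cd[of m] a by (auto simp: K_cd_def)
  qed
  show ?thesis using a b c d e by blast
qed

end
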